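(* Let $\phi:X\to\mathcal H$ be a weakly measurable function with generalized frame operator $\mathsf T_\phi$. The following statements hold. (i) If $\phi$ is not $\mu$-total, then there does not exist a metric operator $G$ on $\mathcal H$ such that $G\phi$ is a frame of $\mathcal H$ and $G^{-1}$ is bounded. (ii) If $\phi$ is a Bessel mapping of $\mathcal H$ and is not $\mu$-total, then there does not exist a metric operator $G$ on $\mathcal H$ such that $G\phi$ is a frame of $\mathcal H$. (iii) If $D(C_\phi)$ is not dense in $\mathcal H$, then there does not exist a metric operator $G$ on $\mathcal H$ such that $G\phi$ is a frame of $\mathcal H$. (iv) If $D(C_\phi)$ is dense in $\mathcal H$ and $\phi$ is a lower semi-frame of $\mathcal H$, then there exists a metric operator $G$ on $\mathcal H$ such that $G\phi$ is a Parseval frame of $\mathcal H$. In particular, a possible choice is $G=\mathsf T_\phi^{-1/2}$. (v) If $\phi$ is $\mu$-total, $D(C_\phi)$ is dense in $\mathcal H$ and $\phi_x\in R(\mathsf T_\phi)$ for all $x\in X$, then there exists a metric operator $G$ on $\mathcal H$ such that $G\phi$ is a Parseval frame of $\mathcal H$. In particular, a possible choice is $G=\mathsf T_\phi^{-1/2}$.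
   Context: $\mathcal H$ is a separable Hilbert space with inner product $\langle\cdot|\cdot\rangle$ linear in the first factor, and $(X,\mu)$ is a locally compact space with a Radon measure $\mu$. A function $\phi:X\to\mathcal H$, $x\mapsto\phi_x$, is weakly measurable if $x\mapsto\langle f|\phi_x\rangle$ is measurable for every $f\in\mathcal H$. A weakly measurable function $\phi$ is: $\mu$-total (briefly, total) if $\langle f|\phi_x\rangle=0$ for a.e. $x\in X$ implies $f=0$; a Bessel mapping of $\mathcal H$ if there is $\mathsf M<\infty$ with $\int_X|\langle f|\phi_x\rangle|^2d\mu(x)\le\mathsf M\|f\|^2$ for all $f\in\mathcal H$; a lower semi-frame of $\mathcal H$ if there is $\mathsf m>0$ with $\mathsf m\|f\|^2\le\int_X|\langle f|\phi_x\rangle|^2d\mu(x)$ for all $f\in\mathcal H$ (the integral may be $+\infty$); a (continuous) frame of $\mathcal H$ if it satisfies both conditions; a Parseval frame of $\mathcal H$ if $\int_X|\langle f|\phi_x\rangle|^2d\mu(x)=\|f\|^2$ for all $f\in\mathcal H$. The analysis operator is $C_\phi:D(C_\phi)\subseteq\mathcal H\to L^2(X,d\mu)$, with $D(C_\phi)=\{f\in\mathcal H:\int_X|\langle f|\phi_x\rangle|^2d\mu(x)<\infty\}$ and $(C_\phi f)(x)=\langle f|\phi_x\rangle$; it is closed. Let $\mathcal H_\phi$ be the closure of $D(C_\phi)$ in $\mathcal H$. The generalized frame operator $\mathsf T_\phi$ is the non-negative self-adjoint operator in $\mathcal H_\phi$ associated by Kato's representation theorem to the closed non-negative form $\Omega_\phi(f,g)=\int_X\langle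 f|\phi_x\rangle\langle\phi_x|g\rangle\,d\mu(x)$, $f,g\in D(C_\phi)$; that is, $D(\mathsf T_\phi)\subset D(C_\phi)=D(\mathsf T_\phi^{1/2})$, $\Omega_\phi(f,g)=\langle\mathsf T_\phi f|g\rangle$ for $f\in D(\mathsf T_\phi)$, $g\in D(C_\phi)$, and $\mathsf T_\phi=C_\phi^\times C_\phi$, where $C_\phi^\times$ is the adjoint of $C_\phi$ regarded as an operator from $\mathcal H_\phi$ to $L^2(X,\mu)$. If $D(C_\phi)$ is dense then $\mathcal H_\phi=\mathcal H$. $R(\cdot)$ denotes the range of an operator. A metric operator on $\mathcal H$ is a (possibly unbounded) strictly positive self-adjoint operator $G$, i.e. $\langle Gf|f\rangle\ge0$ for every $f\in D(G)$, and $\langle Gf|f\rangle=0$ if and only if $f=0$. $G\phi$ denotes the function $x\mapsto G\phi_x$, and writing $G\phi$ implicitly means that $\phi_x\in D(G)$ for all $x\in X$. *)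

theory Defs
  imports "HOL-Analysis.Analysis"
begin

section \<open>Complex Hilbert spaces\<close>

text \<open>The inner product is linear in its first argument. It is tied to the norm by
  \<open>cinner_self\<close>, so that positive definiteness is inherited from the norm axioms.\<close>

class complex_hilbert = banach +
  fixes scaleC :: "complex \<Rightarrow> 'a \<Rightarrow> 'a"
    and cinner :: "'a \<Rightarrow> 'a \<Rightarrow> complex"
  assumes scaleC_of_real: "scaleC (complex_of_real r) x = scaleR r x"
    and scaleC_add_right: "scaleC a (x + y) = scaleC a x + scaleC a y"
    and scaleC_add_left: "scaleC (a + b) x = scaleC a x + scaleC b x"
    and scaleC_scaleC: "scaleC a (scaleC b x) = scaleC (a * b) x"
    and cinner_commute: "cinner x y = cnj (cinner y x)"
    and cinner_add_left: "cinner (x + y) z = cinner x z + cinner y z"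
    and cinner_scaleC_left: "cinner (scaleC a x) y = a * cinner x y"
    and cinner_self: "cinner x x = complex_of_real ((norm x)\<^sup>2)"


section \<open>Unbounded operators\<close>

text \<open>A possibly unbounded operator is a partial map: its domain and range are \<^const>\<open>dom\<close> and
  \<^const>\<open>ran\<close>, composition is \<^const>\<open>map_comp\<close> (which gives products of operators their natural
  domain), and two operators are equal iff they have the same domain and agree on it.\<close>

definition linear_operator :: "('h::complex_hilbert \<rightharpoonup> 'h) \<Rightarrow> bool" where
  "linear_operator A \<longleftrightarrow>
     0 \<in> dom A \<and>
     (\<forall>f\<in>dom A. \<forall>g\<in>dom A. f + g \<in> dom A \<and> the (A (f + g)) = the (A f) + the (A g)) \<and>
     (\<forall>c. \<forall>f\<in>dom A. scaleC c f \<in> dom A \<and> the (A (scaleC c f)) = scaleC c (the (A f)))"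

definition densely_defined :: "('h::complex_hilbert \<rightharpoonup> 'h) \<Rightarrow> bool" where
  "densely_defined A \<longleftrightarrow> closure (dom A) = UNIV"

text \<open>Only meaningful for densely defined \<open>A\<close>; then the vector \<open>h\<close> below is unique.\<close>

definition adjoint_operator :: "('h::complex_hilbert \<rightharpoonup> 'h) \<Rightarrow> ('h \<rightharpoonup> 'h)" where
  "adjoint_operator A = (\<lambda>g.
     if \<exists>h. \<forall>f\<in>dom A. cinner (the (A f)) g = cinner f h
     then Some (THE h. \<forall>f\<in>dom A. cinner (the (A f)) g = cinner f h)
     else None)"

definition self_adjoint :: "('h::complex_hilbert \<rightharpoonup> 'h) \<Rightarrow> bool" where
  "self_adjoint A \<longleftrightarrow> linear_operator A \<and> densely_defined A \<and> adjoint_operator A = A"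

definition nonneg_operator :: "('h::complex_hilbert \<rightharpoonup> 'h) \<Rightarrow> bool" where
  "nonneg_operator A \<longleftrightarrow> (\<forall>f\<in>dom A. cinner (the (A f)) f \<in> \<real>\<^sub>\<ge>\<^sub>0)"

definition metric_operator :: "('h::complex_hilbert \<rightharpoonup> 'h) \<Rightarrow> bool" where
  "metric_operator G \<longleftrightarrow> self_adjoint G \<and> nonneg_operator G \<and>
     (\<forall>f\<in>dom G. cinner (the (G f)) f = 0 \<longleftrightarrow> f = 0)"

text \<open>Only meaningful for injective \<open>A\<close>. The domain is the range of \<open>A\<close>, which need not be the
  whole space.\<close>

definition inverse_operator :: "('h \<rightharpoonup> 'h) \<Rightarrow> ('h \<rightharpoonup> 'h)" where
  "inverse_operator A = (\<lambda>g. if g \<in> ran A then Some (THE f. A f = Some g) else None)"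

definition bounded_operator :: "('h::complex_hilbert \<rightharpoonup> 'h) \<Rightarrow> bool" where
  "bounded_operator A \<longleftrightarrow> (\<exists>B. \<forall>f\<in>dom A. norm (the (A f)) \<le> B * norm f)"

text \<open>The positive square root of a non-negative self-adjoint operator on the whole space. Such an
  operator has exactly one non-negative self-adjoint square root, so the choice is determined.\<close>

definition sqrt_operator :: "('h::complex_hilbert \<rightharpoonup> 'h) \<Rightarrow> ('h \<rightharpoonup> 'h)" where
  "sqrt_operator A = (SOME S. self_adjoint S \<and> nonneg_operator S \<and> S \<circ>\<^sub>m S = A)"

definition apply_operator :: "('h \<rightharpoonup> 'h) \<Rightarrow> ('x \<Rightarrow> 'h) \<Rightarrow> ('x \<Rightarrow> 'h)" where
  "apply_operator G \<phi> = (\<lambda>x. the (G (\<phi> x)))"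


section \<open>Radon measures\<close>

text \<open>The \<open>\<sigma>\<close>-algebra is allowed to be larger than the Borel one, so that both Borel measures and
  their completions are covered.\<close>

definition radon_measure :: "'x::t2_space measure \<Rightarrow> bool" where
  "radon_measure M \<longleftrightarrow>
     space M = UNIV \<and> sets borel \<subseteq> sets M \<and>
     (\<forall>K. compact K \<longrightarrow> emeasure M K < \<infinity>) \<and>
     (\<forall>A\<in>sets M. emeasure M A = (INF U\<in>{U. open U \<and> A \<subseteq> U}. emeasure M U)) \<and>
     (\<forall>U. open U \<longrightarrow> emeasure M U = (SUP K\<in>{K. compact K \<and> K \<subseteq> U}. emeasure M K))"


section \<open>Frames\<close>

definition weakly_measurable :: "'x measure \<Rightarrow> ('x \<Rightarrow> 'h::complex_hilbert) \<Rightarrow> bool" where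
  "weakly_measurable M \<phi> \<longleftrightarrow> (\<forall>f. (\<lambda>x. cinner f (\<phi> x)) \<in> borel_measurable M)"

definition frame_integral :: "'x measure \<Rightarrow> ('x \<Rightarrow> 'h::complex_hilbert) \<Rightarrow> 'h \<Rightarrow> ennreal" where
  "frame_integral M \<phi> f = (\<integral>\<^sup>+x. ennreal ((norm (cinner f (\<phi> x)))\<^sup>2) \<partial>M)"

definition total_mapping :: "'x measure \<Rightarrow> ('x \<Rightarrow> 'h::complex_hilbert) \<Rightarrow> bool" where
  "total_mapping M \<phi> \<longleftrightarrow> weakly_measurable M \<phi> \<and>
     (\<forall>f. (AE x in M. cinner f (\<phi> x) = 0) \<longrightarrow> f = 0)"

definition bessel_mapping :: "'x measure \<Rightarrow> ('x \<Rightarrow> 'h::complex_hilbert) \<Rightarrow> bool" where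
  "bessel_mapping M \<phi> \<longleftrightarrow> weakly_measurable M \<phi> \<and>
     (\<exists>B::real. \<forall>f. frame_integral M \<phi> f \<le> ennreal (B * (norm f)\<^sup>2))"

definition lower_semi_frame :: "'x measure \<Rightarrow> ('x \<Rightarrow> 'h::complex_hilbert) \<Rightarrow> bool" where
  "lower_semi_frame M \<phi> \<longleftrightarrow> weakly_measurable M \<phi> \<and>
     (\<exists>m::real. m > 0 \<and> (\<forall>f. ennreal (m * (norm f)\<^sup>2) \<le> frame_integral M \<phi> f))"

definition continuous_frame :: "'x measure \<Rightarrow> ('x \<Rightarrow> 'h::complex_hilbert) \<Rightarrow> bool" where
  "continuous_frame M \<phi> \<longleftrightarrow> bessel_mapping M \<phi> \<and> lower_semi_frame M \<phi>"

definition parseval_frame :: "'x measure \<Rightarrow> ('x \<Rightarrow> 'h::complex_hilbert) \<Rightarrow> bool" where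
  "parseval_frame M \<phi> \<longleftrightarrow> weakly_measurable M \<phi> \<and>
     (\<forall>f. frame_integral M \<phi> f = ennreal ((norm f)\<^sup>2))"


section \<open>The generalized frame operator\<close>

text \<open>The domain of the analysis operator \<open>f \<mapsto> (x \<mapsto> \<langle>f|\<phi>\<^sub>x\<rangle>)\<close>.\<close>

definition analysis_domain :: "'x measure \<Rightarrow> ('x \<Rightarrow> 'h::complex_hilbert) \<Rightarrow> 'h set" where
  "analysis_domain M \<phi> = {f. frame_integral M \<phi> f < \<infinity>}"

definition frame_form :: "'x measure \<Rightarrow> ('x \<Rightarrow> 'h::complex_hilbert) \<Rightarrow> 'h \<Rightarrow> 'h \<Rightarrow> complex" where
  "frame_form M \<phi> f g = (LINT x|M. cinner f (\<phi> x) * cinner (\<phi> x) g)"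

text \<open>The operator associated by Kato's representation theorem with the closed form
  \<^const>\<open>frame_form\<close> on \<^const>\<open>analysis_domain\<close>, acting in the closed subspace
  \<open>closure (analysis_domain M \<phi>)\<close>: a vector \<open>f\<close> of the form domain belongs to the operator domain
  iff \<open>\<Omega>(f, \<cdot>)\<close> is represented by a vector \<open>h\<close> of that subspace, and then \<open>f\<close> is mapped to \<open>h\<close>,
  which is unique.\<close>

definition frame_operator :: "'x measure \<Rightarrow> ('x \<Rightarrow> 'h::complex_hilbert) \<Rightarrow> ('h \<rightharpoonup> 'h)" where
  "frame_operator M \<phi> = (\<lambda>f.
     if f \<in> analysis_domain M \<phi> \<and>
        (\<exists>h\<in>closure (analysis_domain M \<phi>).
           \<forall>g\<in>analysis_domain M \<phi>. frame_form M \<phi> f g = cinner h g)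
     then Some (THE h. h \<in> closure (analysis_domain M \<phi>) \<and>
           (\<forall>g\<in>analysis_domain M \<phi>. frame_form M \<phi> f g = cinner h g))
     else None)"

end

theory Submission
  imports Defs
begin

text \<open>Everything rests on the identity \<open>\<langle>f|G\<phi>\<^sub>x\<rangle> = \<langle>Gf|\<phi>\<^sub>x\<rangle>\<close> for \<open>f\<close> in the domain of \<open>G\<close>: on that domain the
  frame integral of \<open>G\<phi>\<close> at \<open>f\<close> is the frame integral of \<open>\<phi>\<close> at \<open>Gf\<close>.

  The three negative statements follow from it. If \<open>G\<phi>\<close> is Bessel, the range of \<open>G\<close> consists of
  vectors with finite frame integral, and the range of an injective self-adjoint operator is dense
  (\<open>analysis_domain_dense_if_bessel\<close>). If \<open>G\<^sup>-\<^sup>1\<close> is bounded, closedness of \<open>G\<close> makes its range the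
  whole space, so a vector annihilated by almost every \<open>\<phi>\<^sub>x\<close> is some \<open>Gg\<close>, and the lower frame bound
  forces \<open>g = 0\<close> (\<open>total_if_inverse_bounded\<close>). If \<open>\<phi>\<close> itself is Bessel, the lower bound for \<open>G\<phi>\<close> and
  the upper bound for \<open>\<phi>\<close> give \<open>m \<parallel>f\<parallel>\<^sup>2 \<le> B \<parallel>Gf\<parallel>\<^sup>2\<close>, so \<open>G\<^sup>-\<^sup>1\<close> is bounded after all
  (\<open>total_if_bessel\<close>).

  For the positive statements let \<open>S\<close> be the square root of the frame operator \<open>T\<close>. The second
  representation theorem for closed forms says that the frame integral of \<open>\<phi>\<close> at \<open>f\<close> is \<open>\<parallel>Sf\<parallel>\<^sup>2\<close> on the
  domain of \<open>S\<close>; so the frame integral of \<open>S\<^sup>-\<^sup>1\<phi>\<close> at \<open>f = Sh\<close> is \<open>\<parallel>Sh\<parallel>\<^sup>2 = \<parallel>f\<parallel>\<^sup>2\<close>, and the Parseval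
  identity extends from the dense range of \<open>S\<close> to the whole space by Fatou's lemma
  (\<open>parseval_frame_if_on_dense\<close>). Totality of \<open>\<phi>\<close> makes \<open>S\<close> injective. A lower frame bound makes \<open>S\<close>
  surjective as well, so that every \<open>\<phi>\<^sub>x\<close> lies in the domain of \<open>S\<^sup>-\<^sup>1\<close>; without it, membership of
  \<open>\<phi>\<^sub>x\<close> in the range of \<open>T = S\<^sup>2\<close> does the same.

  It remains to construct \<open>S\<close> and to prove the representation theorem without spectral theory.
  Fatou's lemma says that the frame form is closed, hence \<open>\<parallel>f - u\<parallel>\<^sup>2 + t \<Omega>(f, f)\<close> has a minimiser
  \<open>f = R\<^sub>t u\<close>, and its variational equation says \<open>R\<^sub>t = (1 + t T)\<^sup>-\<^sup>1\<close>. With \<open>B = R\<^sub>1\<close> both \<open>B\<close> and \<open>1 - B\<close>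
  are symmetric contractions, and so they have commuting roots \<open>b\<close> and \<open>a\<close> with \<open>a\<^sup>2 + b\<^sup>2 = 1\<close>;
  the operator \<open>b u \<mapsto> a u\<close> is self-adjoint, and its square is \<open>B u \<mapsto> u - B u\<close>, which is \<open>T\<close>
  (\<open>square_root_of_resolvent_generator\<close>). Finally \<open>R\<^sub>t\<close> commutes with every root of \<open>T\<close> and tends
  strongly to the identity as \<open>t \<rightarrow> 0\<close>, which transports \<open>\<Omega>(f, f) = \<parallel>Sf\<parallel>\<^sup>2\<close> from the domain of \<open>T\<close>
  to that of \<open>S\<close> (\<open>norm_square_root_eq_form\<close>).\<close>


section \<open>Geometry of complex Hilbert spaces\<close>

lemma scaleC_minus_one: "scaleC (-1) (x::'h::complex_hilbert) = - x"
  using scaleC_of_real[of "-1" x] by simp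

lemma scaleC_scaleR: "scaleC c (r *\<^sub>R x) = r *\<^sub>R scaleC c (x::'h::complex_hilbert)"
  by (metis mult.commute scaleC_of_real scaleC_scaleC)

lemma cinner_scaleR_left: "cinner (r *\<^sub>R x) (y::'h::complex_hilbert) = of_real r * cinner x y"
  by (metis cinner_scaleC_left scaleC_of_real)

lemma cinner_zero_left [simp]: "cinner 0 (y::'h::complex_hilbert) = 0"
  using cinner_scaleR_left[of 0 0 y] by simp

lemma cinner_minus_left: "cinner (- x) (y::'h::complex_hilbert) = - cinner x y"
  using cinner_scaleR_left[of "-1" x y] by simp

lemma cinner_diff_left: "cinner (x - y) (z::'h::complex_hilbert) = cinner x z - cinner y z"
  using cinner_add_left[of x "- y" z] by (simp add: cinner_minus_left)

lemma cinner_add_right: "cinner x (y + z) = cinner x y + cinner x (z::'h::complex_hilbert)"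
  by (metis cinner_add_left cinner_commute complex_cnj_add)

lemma cinner_zero_right [simp]: "cinner (x::'h::complex_hilbert) 0 = 0"
  by (metis cinner_commute cinner_zero_left complex_cnj_zero)

lemma cinner_diff_right: "cinner x (y - z) = cinner x y - cinner x (z::'h::complex_hilbert)"
  by (metis cinner_diff_left cinner_commute complex_cnj_diff)

lemma cinner_scaleC_right: "cinner x (scaleC c y) = cnj c * cinner x (y::'h::complex_hilbert)"
  by (metis cinner_scaleC_left cinner_commute complex_cnj_mult)

lemma cinner_scaleR_right: "cinner x (r *\<^sub>R y) = of_real r * cinner x (y::'h::complex_hilbert)"
  by (metis cinner_scaleC_right complex_cnj_complex_of_real scaleC_of_real)

lemma power2_norm_eq_cinner: "(norm (x::'h::complex_hilbert))\<^sup>2 = Re (cinner x x)"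
  by (simp add: cinner_self)

lemma cinner_self_eq_0 [simp]: "cinner x x = 0 \<longleftrightarrow> (x::'h::complex_hilbert) = 0"
  by (simp add: cinner_self)

lemma cinner_eqI: "(\<And>z. cinner x z = cinner y z) \<Longrightarrow> x = (y::'h::complex_hilbert)"
  by (metis cinner_diff_left cinner_self_eq_0 right_minus_eq)

text \<open>The first-variation argument over the complex numbers: a quadratic function of \<open>c\<close> that
  is non-negative everywhere and vanishes at \<open>0\<close> has no linear part. Moving in the direction \<open>c = - s z\<close>
  with \<open>s\<close> small would otherwise make it negative.\<close>

lemma Re_quadratic_nonneg_imp_eq_0:
  assumes "\<And>c. 0 \<le> 2 * Re (cnj c * z) + (norm c)\<^sup>2 * k"
  shows "z = 0"
proof (rule ccontr)
  assume z: "z \<noteq> 0"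
  \<comment> \<open>any step \<open>s > 0\<close> with \<open>s k < 2\<close> would do\<close>
  define s where "s = 1 / (\<bar>k\<bar> + 1)"
  have s: "s > 0" "s * k \<le> 1" "s * k < 2" by (auto simp: s_def field_simps intro: add_pos_nonneg add_nonneg_pos)
  have *: "Re (cnj (complex_of_real (- s) * z) * z) = - s * (norm z)\<^sup>2"
    by (simp add: cmod_power2 algebra_simps) (simp add: power2_eq_square)
  have "0 \<le> 2 * (- s * (norm z)\<^sup>2) + (norm (complex_of_real (- s) * z))\<^sup>2 * k"
    using assms[of "complex_of_real (- s) * z"] unfolding * .
  also have "\<dots> = (s * (norm z)\<^sup>2) * (s * k - 2)"
    by (simp add: norm_mult power_mult_distrib power2_eq_square algebra_simps)
  also have "\<dots> < 0" using s z by (intro mult_pos_neg) auto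
  finally show False by simp
qed

text \<open>One set of axioms covers the inner product, the frame form on its domain, and the form
  \<open>(f, g) \<mapsto> \<langle>Sf|g\<rangle>\<close> of a non-negative self-adjoint operator, so that the Cauchy--Schwarz inequality is
  proved once for all three.\<close>

locale nonneg_form =
  fixes V :: "'h::complex_hilbert set" and E :: "'h \<Rightarrow> 'h \<Rightarrow> complex"
  assumes zero_mem: "0 \<in> V"
    and add_mem: "f \<in> V \<Longrightarrow> g \<in> V \<Longrightarrow> f + g \<in> V"
    and scaleC_mem: "f \<in> V \<Longrightarrow> scaleC c f \<in> V"
    and form_add_left: "f \<in> V \<Longrightarrow> g \<in> V \<Longrightarrow> h \<in> V \<Longrightarrow> E (f + g) h = E f h + E g h"
    and form_scaleC_left: "f \<in> V \<Longrightarrow> g \<in> V \<Longrightarrow> E (scaleC c f) g = c * E f g"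
    and form_commute: "f \<in> V \<Longrightarrow> g \<in> V \<Longrightarrow> E f g = cnj (E g f)"
    and form_nonneg: "f \<in> V \<Longrightarrow> 0 \<le> Re (E f f)"
begin

lemma scaleR_mem: "f \<in> V \<Longrightarrow> r *\<^sub>R f \<in> V"
  by (metis scaleC_mem scaleC_of_real)

lemma diff_mem: "f \<in> V \<Longrightarrow> g \<in> V \<Longrightarrow> f - g \<in> V"
  using add_mem[of f "scaleC (-1) g"] scaleC_mem[of g "-1"] by (simp add: scaleC_minus_one)

lemma form_add_right: "f \<in> V \<Longrightarrow> g \<in> V \<Longrightarrow> h \<in> V \<Longrightarrow> E f (g + h) = E f g + E f h"
  by (metis add_mem form_add_left form_commute complex_cnj_add)

lemma form_scaleC_right: "f \<in> V \<Longrightarrow> g \<in> V \<Longrightarrow> E f (scaleC c g) = cnj c * E f g"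
  by (metis scaleC_mem form_scaleC_left form_commute complex_cnj_mult)

lemma form_self_real: "f \<in> V \<Longrightarrow> E f f = of_real (Re (E f f))"
  using form_commute[of f f] by (auto simp: complex_eq_iff)

lemma form_diff_left: "f \<in> V \<Longrightarrow> g \<in> V \<Longrightarrow> h \<in> V \<Longrightarrow> E (f - g) h = E f h - E g h"
  using form_add_left[of f "scaleC (-1) g" h] scaleC_mem[of g "-1"] form_scaleC_left[of g h "-1"]
  by (simp add: scaleC_minus_one)

lemma quadratic_add:
  assumes "f \<in> V" "g \<in> V"
  shows "Re (E (f + g) (f + g)) = Re (E f f) + Re (E g g) + 2 * Re (E f g)"
  using assms form_commute[of f g] by (simp add: form_add_left form_add_right add_mem)

lemma quadratic_scaleC:
  assumes "f \<in> V"
  shows "Re (E (scaleC c f) (scaleC c f)) = (norm c)\<^sup>2 * Re (E f f)"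
proof -
  have "E (scaleC c f) (scaleC c f) = (c * cnj c) * E f f"
    using assms by (simp add: form_scaleC_left form_scaleC_right scaleC_mem)
  also have "\<dots> = of_real ((norm c)\<^sup>2 * Re (E f f))"
    using form_self_real[OF assms] by (metis complex_norm_square of_real_mult)
  finally show ?thesis by (metis Re_complex_of_real)
qed

lemma quadratic_line:
  assumes "f \<in> V" "g \<in> V"
  shows "Re (E (f + scaleC c g) (f + scaleC c g)) =
    Re (E f f) + 2 * Re (cnj c * E f g) + (norm c)\<^sup>2 * Re (E g g)"
  unfolding quadratic_add[OF assms(1) scaleC_mem[OF assms(2)]]
  using assms by (simp only: quadratic_scaleC form_scaleC_right)

lemma Cauchy_Schwarz:
  assumes f: "f \<in> V" and g: "g \<in> V"
  shows "(norm (E f g))\<^sup>2 \<le> Re (E f f) * Re (E g g)"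
proof (cases "Re (E g g) = 0")
  case True
  have "cnj (E f g) = 0"
  proof (rule Re_quadratic_nonneg_imp_eq_0)
    fix c
    show "0 \<le> 2 * Re (cnj c * cnj (E f g)) + (norm c)\<^sup>2 * Re (E f f)"
      using form_nonneg[of "g + scaleC c f"] quadratic_line[OF g f, of c] True f g form_commute[of f g]
      by (simp add: add_mem scaleC_mem)
  qed
  then show ?thesis using True by simp
next
  case False
  define k where "k = Re (E g g)"
  \<comment> \<open>this \<open>c\<close> minimises the form on the line through \<open>f\<close> in the direction of \<open>g\<close>\<close>
  define c where "c = - (E f g / of_real k)"
  have k: "k > 0" using False form_nonneg[OF g] by (simp add: k_def)
  have 1: "Re (cnj c * E f g) = - ((norm (E f g))\<^sup>2 / k)"
    by (simp add: c_def cmod_power2 field_simps) (simp add: power2_eq_square)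
  have 2: "(norm c)\<^sup>2 * k = (norm (E f g))\<^sup>2 / k"
    using k by (simp add: c_def norm_divide power2_eq_square field_simps)
  have "0 \<le> Re (E f f) + 2 * Re (cnj c * E f g) + (norm c)\<^sup>2 * k"
    using form_nonneg[of "f + scaleC c g"] quadratic_line[OF f g, of c] f g
    by (simp add: add_mem scaleC_mem k_def)
  then have "(norm (E f g))\<^sup>2 / k \<le> Re (E f f)" unfolding 1 2 by simp
  then show ?thesis using k by (simp add: field_simps k_def[symmetric])
qed

lemma form_eq_0_of_quadratic_eq_0:
  assumes "f \<in> V" "g \<in> V" "Re (E f f) = 0"
  shows "E f g = 0"
  using Cauchy_Schwarz[OF assms(1,2)] assms(3) by simp

end

lemma nonneg_form_cinner: "nonneg_form UNIV (cinner :: 'h::complex_hilbert \<Rightarrow> 'h \<Rightarrow> complex)"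
  by unfold_locales
    (simp_all add: cinner_add_left cinner_scaleC_left power2_norm_eq_cinner[symmetric] cinner_commute[symmetric])

lemma norm_cinner_le: "norm (cinner x y) \<le> norm x * norm (y::'h::complex_hilbert)"
proof -
  have "(norm (cinner x y))\<^sup>2 \<le> (norm x * norm y)\<^sup>2"
    using nonneg_form.Cauchy_Schwarz[OF nonneg_form_cinner, of x y]
    by (simp add: power_mult_distrib power2_norm_eq_cinner)
  then show ?thesis by (simp add: power2_le_iff_abs_le)
qed

lemma power2_norm_add:
  "(norm (x + y))\<^sup>2 = (norm x)\<^sup>2 + (norm y)\<^sup>2 + 2 * Re (cinner x (y::'h::complex_hilbert))"
  using nonneg_form.quadratic_add[OF nonneg_form_cinner, of x y] by (simp add: power2_norm_eq_cinner)

lemma norm_scaleC: "norm (scaleC c x) = norm c * norm (x::'h::complex_hilbert)"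
proof -
  have "(norm (scaleC c x))\<^sup>2 = (norm c * norm x)\<^sup>2"
    using nonneg_form.quadratic_scaleC[OF nonneg_form_cinner, where f = x and c = c]
    by (simp add: power2_norm_eq_cinner power_mult_distrib)
  then show ?thesis by simp
qed

lemma bounded_bilinear_cinner: "bounded_bilinear (cinner :: 'h::complex_hilbert \<Rightarrow> 'h \<Rightarrow> complex)"
proof
  show "\<exists>K. \<forall>a b. norm (cinner a (b::'h)) \<le> norm a * norm b * K"
    by (intro exI[of _ 1]) (simp add: norm_cinner_le)
qed (simp_all add: cinner_add_left cinner_add_right cinner_scaleR_left cinner_scaleR_right scaleR_conv_of_real)

lemmas tendsto_cinner [tendsto_intros] = bounded_bilinear.tendsto[OF bounded_bilinear_cinner]

lemma tendsto_scaleC [tendsto_intros]: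
  fixes f :: "'a \<Rightarrow> 'h::complex_hilbert"
  assumes "(f \<longlongrightarrow> l) F"
  shows "((\<lambda>x. scaleC c (f x)) \<longlongrightarrow> scaleC c l) F"
proof -
  have "bounded_linear (scaleC c :: 'h \<Rightarrow> 'h)"
    by (rule bounded_linear_intro[where K = "norm c"])
      (simp_all add: scaleC_add_right scaleC_scaleR norm_scaleC mult.commute)
  then show ?thesis using assms by (rule bounded_linear.tendsto)
qed

lemma eq_of_cinner_eq_on_dense:
  fixes x y :: "'h::complex_hilbert"
  assumes "closure V = UNIV" and "\<And>z. z \<in> V \<Longrightarrow> cinner x z = cinner y z"
  shows "x = y"
proof -
  have "x - y \<in> closure V" using assms(1) by simp
  then obtain z where z: "\<And>n. z n \<in> V" "z \<longlonglongrightarrow> x - y"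
    unfolding closure_sequential by blast
  have "(\<lambda>n. cinner (x - y) (z n)) \<longlonglongrightarrow> cinner (x - y) (x - y)"
    by (intro tendsto_intros z)
  moreover have "(\<lambda>n. cinner (x - y) (z n)) = (\<lambda>_. 0)"
    using assms(2) z(1) by (simp add: cinner_diff_left)
  ultimately have "cinner (x - y) (x - y) = 0"
    by (metis LIMSEQ_const_iff)
  then show ?thesis by simp
qed

section \<open>Closed forms and their minimisers\<close>

text \<open>Closedness is expressed as lower semicontinuity of the quadratic form, set to \<open>+\<infinity>\<close> off its
  domain. This is equivalent to completeness of the domain in the form norm, and it is what Fatou's
  lemma delivers for frame forms and what the direct method of the calculus of variations consumes.\<close>

locale closed_form = nonneg_form +
  assumes lower_semicontinuous:
    "(\<And>n::nat. X n \<in> V) \<Longrightarrow> X \<longlonglongrightarrow> f \<Longrightarrow> (\<And>n. Re (E (X n) (X n)) \<le> K) \<Longrightarrow>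
      f \<in> V \<and> Re (E f f) \<le> K"
begin

text \<open>By the parallelogram law the functional is uniformly convex in the Hilbert norm, so a
  minimising sequence is Cauchy; lower semicontinuity shows that its limit is a minimiser.\<close>

lemma minimiser_exists:
  assumes t: "0 < t"
  obtains f where "f \<in> V"
    "\<And>g. g \<in> V \<Longrightarrow> (norm (f - u))\<^sup>2 + t * Re (E f f) \<le> (norm (g - u))\<^sup>2 + t * Re (E g g)"
proof -
  define J where "J g = (norm (g - u))\<^sup>2 + t * Re (E g g)" for g
  define m where "m = (INF g\<in>V. J g)"
  have bdd: "bdd_below (J ` V)"
    using t form_nonneg by (intro bdd_belowI2[of _ 0]) (auto simp: J_def)
  have m_le: "m \<le> J g" if "g \<in> V" for g
    unfolding m_def by (rule cINF_lower[OF bdd that])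
  have "\<exists>g\<in>V. J g < m + 1 / real (Suc n)" for n
    using cINF_less_iff[OF _ bdd, of "m + 1 / real (Suc n)"] zero_mem
    by (auto simp: m_def[symmetric])
  then obtain X where X: "\<And>n. X n \<in> V" "\<And>n. J (X n) < m + 1 / real (Suc n)" by metis
  have midpoint: "(norm (f - g))\<^sup>2 / 4 + m \<le> (J f + J g) / 2" if fg: "f \<in> V" "g \<in> V" for f g
  proof -
    let ?h = "(1/2) *\<^sub>R (f + g)" and ?k = "(1/2) *\<^sub>R (f - g)"
    have V: "?h \<in> V" "?k \<in> V" using fg by (auto intro!: scaleR_mem add_mem diff_mem)
    have "f = ?h + ?k" "g = ?h + scaleC (-1) ?k"
      by (simp_all add: scaleC_minus_one algebra_simps flip: scaleR_left.add)
    then have 1: "Re (E f f) + Re (E g g) = 2 * Re (E ?h ?h) + 2 * Re (E ?k ?k)"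
      using quadratic_add[OF V] quadratic_line[OF V, of "-1"] by simp
    have e: "f - u = (?h - u) + ?k" "g - u = (?h - u) + (- ?k)"
      by (simp_all add: algebra_simps flip: scaleR_left.add)
    have 2: "(norm (f - u))\<^sup>2 + (norm (g - u))\<^sup>2 = 2 * (norm (?h - u))\<^sup>2 + 2 * (norm ?k)\<^sup>2"
      unfolding e power2_norm_add using cinner_diff_right[of "?h - u" 0 ?k] by (simp del: scaleR_right_diff_distrib)
    have 3: "(norm ?k)\<^sup>2 = (norm (f - g))\<^sup>2 / 4" by (simp add: power_divide)
    have "J f + J g = ((norm (f - u))\<^sup>2 + (norm (g - u))\<^sup>2) + t * (Re (E f f) + Re (E g g))"
      by (simp add: J_def algebra_simps)
    also have "\<dots> = 2 * J ?h + (norm (f - g))\<^sup>2 / 2 + t * (2 * Re (E ?k ?k))"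
      unfolding 1 2 3 by (simp add: J_def algebra_simps)
    also have "\<dots> \<ge> 2 * m + (norm (f - g))\<^sup>2 / 2 + 0"
      using m_le[OF V(1)] form_nonneg[OF V(2)] t by (intro add_mono) auto
    finally show ?thesis by simp
  qed
  have "Cauchy X"
  proof (rule CauchyI)
    fix e :: real assume e: "0 < e"
    obtain N where N: "4 / real (Suc N) < e\<^sup>2"
      using e reals_Archimedean[of "e\<^sup>2 / 4"] by (auto simp: field_simps)
    show "\<exists>N. \<forall>k\<ge>N. \<forall>n\<ge>N. norm (X k - X n) < e"
    proof (intro exI allI impI)
      fix k n assume kn: "N \<le> k" "N \<le> n"
      have "1 / real (Suc k) \<le> 1 / real (Suc N)" "1 / real (Suc n) \<le> 1 / real (Suc N)"
        using kn by (auto intro!: divide_left_mono)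
      then have "(norm (X k - X n))\<^sup>2 \<le> 4 / real (Suc N)"
        using midpoint[OF X(1)[of k] X(1)[of n]] X(2)[of k] X(2)[of n] by argo
      also have "\<dots> < e\<^sup>2" by (rule N)
      finally show "norm (X k - X n) < e" using e by (simp add: power2_less_imp_less)
    qed
  qed
  then obtain f where f: "X \<longlonglongrightarrow> f" using Cauchy_convergent convergent_def by blast
  have lim: "(\<lambda>n. (m + 1 / real (Suc n) - (norm (X n - u))\<^sup>2) / t) \<longlonglongrightarrow> (m + 0 - (norm (f - u))\<^sup>2) / t"
    using t by (intro tendsto_intros f LIMSEQ_inverse_real_of_nat[unfolded inverse_eq_divide]) auto
  have Q: "f \<in> V \<and> Re (E f f) \<le> K" if K: "(m - (norm (f - u))\<^sup>2) / t < K" for K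
  proof -
    have "\<forall>\<^sub>F n in sequentially. (m + 1 / real (Suc n) - (norm (X n - u))\<^sup>2) / t < K"
      using order_tendstoD(2)[OF lim] K by simp
    then obtain N where N: "\<And>n. n \<ge> N \<Longrightarrow> (m + 1 / real (Suc n) - (norm (X n - u))\<^sup>2) / t < K"
      by (auto simp: eventually_sequentially)
    show ?thesis
    proof (rule lower_semicontinuous)
      show "(\<lambda>n. X (n + N)) \<longlonglongrightarrow> f" using f by (rule LIMSEQ_ignore_initial_segment)
      fix n
      show "X (n + N) \<in> V" by (rule X)
      have "Re (E (X (n + N)) (X (n + N))) \<le> (m + 1 / real (Suc (n + N)) - (norm (X (n + N) - u))\<^sup>2) / t"
        using X(2)[of "n + N"] t by (simp add: J_def pos_le_divide_eq mult.commute)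
      also have "\<dots> \<le> K" using N[of "n + N"] by simp
      finally show "Re (E (X (n + N)) (X (n + N))) \<le> K" .
    qed
  qed
  have "f \<in> V" using Q[OF less_add_one] by simp
  moreover have "Re (E f f) \<le> (m - (norm (f - u))\<^sup>2) / t"
    by (rule dense_ge) (use Q in blast)
  then have "J f \<le> m" using t by (simp add: J_def field_simps)
  ultimately show ?thesis using m_le that[of f] unfolding J_def by force
qed

text \<open>The first-variation equation of the minimiser is the weak form of \<open>(1 + t T) f = u\<close>, where
  \<open>T\<close> is the operator of the form. Minimality is kept in the conclusion because it shows how fast \<open>f\<close>
  approaches \<open>u\<close> as \<open>t\<close> tends to \<open>0\<close>.\<close>

lemma resolvent_equation:
  assumes t: "0 < t"
  obtains f where "f \<in> V" "\<And>g. g \<in> V \<Longrightarrow> cinner f g + of_real t * E f g = cinner u g"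
    "\<And>g. g \<in> V \<Longrightarrow> (norm (f - u))\<^sup>2 + t * Re (E f f) \<le> (norm (g - u))\<^sup>2 + t * Re (E g g)"
proof -
  obtain f where f: "f \<in> V"
    "\<And>g. g \<in> V \<Longrightarrow> (norm (f - u))\<^sup>2 + t * Re (E f f) \<le> (norm (g - u))\<^sup>2 + t * Re (E g g)"
    using minimiser_exists[OF t] by blast
  have "cinner f g + of_real t * E f g = cinner u g" if g: "g \<in> V" for g
  proof -
    have "cinner (f - u) g + of_real t * E f g = 0"
    proof (rule Re_quadratic_nonneg_imp_eq_0)
      fix c
      define p where "p = Re (cnj c * cinner (f - u) g)"
      define q where "q = Re (cnj c * E f g)"
      have "(norm (f + scaleC c g - u))\<^sup>2 = (norm (f - u))\<^sup>2 + 2 * p + (norm c)\<^sup>2 * (norm g)\<^sup>2"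
        using nonneg_form.quadratic_line[OF nonneg_form_cinner, of "f - u" g c]
        by (simp add: power2_norm_eq_cinner p_def diff_add_eq)
      moreover have "Re (E (f + scaleC c g) (f + scaleC c g)) =
          Re (E f f) + 2 * q + (norm c)\<^sup>2 * Re (E g g)"
        using quadratic_line[OF f(1) g, of c] by (simp only: q_def)
      moreover have "(norm (f - u))\<^sup>2 + t * Re (E f f) \<le>
          (norm (f + scaleC c g - u))\<^sup>2 + t * Re (E (f + scaleC c g) (f + scaleC c g))"
        by (intro f(2) add_mem scaleC_mem f(1) g)
      ultimately have "0 \<le> 2 * (p + t * q) + (norm c)\<^sup>2 * ((norm g)\<^sup>2 + t * Re (E g g))"
        by (simp only:) (simp add: algebra_simps)
      also have "p + t * q = Re (cnj c * (cinner (f - u) g + of_real t * E f g))"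
        by (simp add: p_def q_def algebra_simps)
      finally show "0 \<le> 2 * Re (cnj c * (cinner (f - u) g + of_real t * E f g))
          + (norm c)\<^sup>2 * ((norm g)\<^sup>2 + t * Re (E g g))" .
    qed
    then show ?thesis by (simp add: cinner_diff_left algebra_simps)
  qed
  then show ?thesis using that f by blast
qed

end

text \<open>The zero form on a closed subspace is a closed form, and its minimiser is the orthogonal
  projection onto the subspace.\<close>

lemma dense_if_orthogonal_complement_trivial:
  fixes V :: "'h::complex_hilbert set"
  assumes zero: "0 \<in> V" and add: "\<And>f g. f \<in> V \<Longrightarrow> g \<in> V \<Longrightarrow> f + g \<in> V"
    and scale: "\<And>c f. f \<in> V \<Longrightarrow> scaleC c f \<in> V"
    and trivial: "\<And>u. (\<And>g. g \<in> V \<Longrightarrow> cinner u g = 0) \<Longrightarrow> u = 0"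
  shows "closure V = UNIV"
proof -
  interpret closed_form "closure V" "\<lambda>_ _. 0"
  proof
    show "0 \<in> closure V" using zero closure_subset by blast
    show "f + g \<in> closure V" if fg: "f \<in> closure V" "g \<in> closure V" for f g
    proof -
      obtain x where "\<And>n. x n \<in> V" "x \<longlonglongrightarrow> f" using fg(1) unfolding closure_sequential by blast
      moreover obtain y where "\<And>n. y n \<in> V" "y \<longlonglongrightarrow> g" using fg(2) unfolding closure_sequential by blast
      ultimately have "\<forall>n. x n + y n \<in> V" "(\<lambda>n. x n + y n) \<longlonglongrightarrow> f + g"
        by (auto intro: add tendsto_add)
      then show ?thesis unfolding closure_sequential by (intro exI[of _ "\<lambda>n. x n + y n"] conjI)
    qed
    show "scaleC c f \<in> closure V" if f: "f \<in> closure V" for c f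
    proof -
      obtain x where "\<And>n. x n \<in> V" "x \<longlonglongrightarrow> f" using f unfolding closure_sequential by blast
      then have "\<forall>n. scaleC c (x n) \<in> V" "(\<lambda>n. scaleC c (x n)) \<longlonglongrightarrow> scaleC c f"
        by (auto intro: scale tendsto_scaleC)
      then show ?thesis unfolding closure_sequential by (intro exI[of _ "\<lambda>n. scaleC c (x n)"] conjI)
    qed
    show "f \<in> closure V \<and> Re 0 \<le> K"
      if "\<And>n::nat. X n \<in> closure V" "X \<longlonglongrightarrow> f" "\<And>n. Re 0 \<le> K" for X f K
      using that closed_sequentially[OF closed_closure] by blast
  qed simp_all
  have "u \<in> closure V" for u
  proof -
    obtain f where f: "f \<in> closure V" "\<And>g. g \<in> closure V \<Longrightarrow> cinner f g = cinner u g"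
      using resolvent_equation[OF zero_less_one, of u] by (metis add.right_neutral mult_zero_right)
    have "u - f = 0"
      using f(2) subsetD[OF closure_subset[of V]] by (intro trivial) (simp add: cinner_diff_left)
    then show ?thesis using f(1) by simp
  qed
  then show ?thesis by blast
qed


section \<open>Square roots of symmetric contractions\<close>

text \<open>Linearity is not part of the definition: an everywhere defined symmetric map is linear.\<close>

definition symmetric_map :: "('h::complex_hilbert \<Rightarrow> 'h) \<Rightarrow> bool" where
  "symmetric_map X \<longleftrightarrow> (\<forall>x y. cinner (X x) y = cinner x (X y))"

lemma symmetric_map_swap: "symmetric_map X \<Longrightarrow> cinner (X x) y = cinner x (X y)"
  by (simp add: symmetric_map_def)

lemma symmetric_map_add: "symmetric_map X \<Longrightarrow> X (x + y) = X x + X y"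
  by (rule cinner_eqI) (simp add: symmetric_map_swap cinner_add_left)

lemma symmetric_map_diff: "symmetric_map X \<Longrightarrow> X (x - y) = X x - X y"
  by (rule cinner_eqI) (simp add: symmetric_map_swap cinner_diff_left)

lemma symmetric_map_scaleC: "symmetric_map X \<Longrightarrow> X (scaleC c x) = scaleC c (X x)"
  by (rule cinner_eqI) (simp add: symmetric_map_swap cinner_scaleC_left)

lemma symmetric_map_scaleR: "symmetric_map X \<Longrightarrow> X (r *\<^sub>R x) = r *\<^sub>R X x"
  by (rule cinner_eqI) (simp add: symmetric_map_swap cinner_scaleR_left)

lemma symmetric_map_zero: "symmetric_map X \<Longrightarrow> X 0 = 0"
  by (rule cinner_eqI) (simp add: symmetric_map_swap)

definition symmetric_contraction :: "('h::complex_hilbert \<Rightarrow> 'h) \<Rightarrow> bool" where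
  "symmetric_contraction X \<longleftrightarrow> symmetric_map X \<and> (\<forall>x. norm (X x) \<le> norm x)"

lemma symmetric_contraction_tendsto:
  assumes X: "symmetric_contraction X" and f: "(f \<longlongrightarrow> l) F"
  shows "((\<lambda>x. X (f x)) \<longlongrightarrow> X l) F"
proof -
  have "bounded_linear X"
    using X unfolding symmetric_contraction_def
    by (intro bounded_linear_intro[where K = 1]) (auto simp: symmetric_map_add symmetric_map_scaleR)
  then show ?thesis using f by (rule bounded_linear.tendsto)
qed

text \<open>Writing the root of \<open>1 - X\<close> as \<open>1 - Y\<close> turns \<open>(1 - Y)\<^sup>2 = 1 - X\<close> into the fixed point equation
  \<open>Y = (X + Y\<^sup>2) / 2\<close>, which is solved by iteration from \<open>0\<close>.\<close>

primrec root_iterate :: "('h::complex_hilbert \<Rightarrow> 'h) \<Rightarrow> nat \<Rightarrow> 'h \<Rightarrow> 'h" where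
  "root_iterate X 0 = (\<lambda>u. 0)"
| "root_iterate X (Suc n) = (\<lambda>u. (1/2) *\<^sub>R (X u + root_iterate X n (root_iterate X n u)))"

text \<open>The same iteration for the scalar \<open>X = 1\<close>. Since the iterates are polynomials in \<open>X\<close> with
  non-negative coefficients, and so are their successive differences, it dominates the iteration for
  every contraction.\<close>

primrec root_majorant :: "nat \<Rightarrow> real" where
  "root_majorant 0 = 0"
| "root_majorant (Suc n) = (1 + (root_majorant n)\<^sup>2) / 2"

lemma root_majorant_bounds: "0 \<le> root_majorant n" "root_majorant n \<le> 1"
proof (induction n)
  case (Suc n)
  { case 1 show ?case by simp }
  { case 2 show ?case using Suc by (simp add: power_le_one) }
qed simp_all

lemma incseq_root_majorant: "incseq root_majorant"
proof (rule incseq_SucI)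
  fix n
  have "0 \<le> (1 - root_majorant n)\<^sup>2" by simp
  then show "root_majorant n \<le> root_majorant (Suc n)"
    by (simp add: power2_eq_square algebra_simps)
qed

context
  fixes X :: "'h::complex_hilbert \<Rightarrow> 'h"
  assumes X: "symmetric_contraction X"
begin

lemma norm_root_iterate_le: "norm (root_iterate X n u) \<le> root_majorant n * norm u"
proof (induction n arbitrary: u)
  case (Suc n)
  let ?Y = "root_iterate X n" and ?r = "root_majorant n"
  have "norm (?Y (?Y u)) \<le> ?r * (?r * norm u)"
    using Suc[of "?Y u"] mult_left_mono[OF Suc[of u] root_majorant_bounds(1)[of n]] by linarith
  moreover have "norm (X u) \<le> norm u" using X by (simp add: symmetric_contraction_def)
  ultimately have "norm (X u + ?Y (?Y u)) \<le> norm u + ?r * (?r * norm u)"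
    by (metis norm_triangle_mono)
  then show ?case by (simp add: power2_eq_square algebra_simps del: scaleR_add_right)
qed simp

lemma symmetric_contraction_root_iterate: "symmetric_contraction (root_iterate X n)"
  unfolding symmetric_contraction_def
proof
  show "symmetric_map (root_iterate X n)"
    using X by (induction n)
      (simp_all add: symmetric_contraction_def symmetric_map_def cinner_scaleR_left cinner_scaleR_right
        cinner_add_left cinner_add_right)
  show "\<forall>u. norm (root_iterate X n u) \<le> norm u"
    using norm_root_iterate_le root_majorant_bounds(2)
    by (meson mult_left_le_one_le norm_ge_zero order_trans root_majorant_bounds(1))
qed

lemmas symmetric_map_root_iterate =
  symmetric_contraction_root_iterate[unfolded symmetric_contraction_def, THEN conjunct1]

text \<open>Splitting \<open>Z\<^sup>2 - Y\<^sup>2 = Z (Z - Y) + (Z - Y) Y\<close> reproduces the factorisation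
  \<open>s\<^sup>2 - r\<^sup>2 = s (s - r) + (s - r) r\<close> of the majorant, so the domination is inherited by the next step.\<close>

lemma norm_root_iterate_Suc_diff_le:
  "norm (root_iterate X (Suc n) u - root_iterate X n u) \<le> (root_majorant (Suc n) - root_majorant n) * norm u"
proof (induction n arbitrary: u)
  case 0
  then show ?case using X by (simp add: symmetric_contraction_def)
next
  case (Suc n)
  define Y Z where "Y = root_iterate X n" and "Z = root_iterate X (Suc n)"
  define r s where "r = root_majorant n" and "s = root_majorant (Suc n)"
  have rs: "0 \<le> r" "0 \<le> s" "r \<le> s"
    using root_majorant_bounds incseq_SucD[OF incseq_root_majorant] by (simp_all only: r_def s_def)
  have IH: "norm (Z v - Y v) \<le> (s - r) * norm v" for v
    using Suc[of v] by (simp only: Y_def Z_def r_def s_def)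
  have Z: "symmetric_map Z" unfolding Z_def by (rule symmetric_map_root_iterate)
  have "root_iterate X (Suc (Suc n)) u - root_iterate X (Suc n) u =
      (1/2) *\<^sub>R (X u + Z (Z u)) - (1/2) *\<^sub>R (X u + Y (Y u))"
    by (simp only: root_iterate.simps Y_def Z_def)
  also have "\<dots> = (1/2) *\<^sub>R (Z (Z u - Y u) + (Z (Y u) - Y (Y u)))"
    unfolding symmetric_map_diff[OF Z] by (simp add: algebra_simps)
  finally have "norm (root_iterate X (Suc (Suc n)) u - root_iterate X (Suc n) u) \<le>
      (norm (Z (Z u - Y u)) + norm (Z (Y u) - Y (Y u))) / 2"
    using norm_triangle_ineq[of "Z (Z u - Y u)" "Z (Y u) - Y (Y u)"] by simp
  also have "norm (Z (Z u - Y u)) \<le> s * ((s - r) * norm u)"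
    using norm_root_iterate_le[of "Suc n" "Z u - Y u"] mult_left_mono[OF IH[of u] rs(2)]
    by (simp only: Z_def s_def)
  also have "norm (Z (Y u) - Y (Y u)) \<le> (s - r) * (r * norm u)"
    using IH[of "Y u"] mult_left_mono[OF norm_root_iterate_le[of n u], of "s - r"] rs
    by (simp only: Y_def r_def) linarith
  also have "(s * ((s - r) * norm u) + (s - r) * (r * norm u)) / 2 = ((1 + s\<^sup>2) / 2 - (1 + r\<^sup>2) / 2) * norm u"
    by (simp add: power2_eq_square field_simps)
  also have "\<dots> = (root_majorant (Suc (Suc n)) - root_majorant (Suc n)) * norm u"
    by (simp only: root_majorant.simps r_def s_def)
  finally show ?case by simp
qed

lemma norm_root_iterate_diff_le:
  assumes "m \<le> n"
  shows "norm (root_iterate X n u - root_iterate X m u) \<le> (root_majorant n - root_majorant m) * norm u"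
  using assms
proof (induction n rule: dec_induct)
  case (step n)
  have "root_iterate X (Suc n) u - root_iterate X m u =
      (root_iterate X (Suc n) u - root_iterate X n u) + (root_iterate X n u - root_iterate X m u)" by simp
  then have "norm (root_iterate X (Suc n) u - root_iterate X m u) \<le>
      (root_majorant (Suc n) - root_majorant n) * norm u + (root_majorant n - root_majorant m) * norm u"
    using norm_triangle_mono[OF norm_root_iterate_Suc_diff_le[of n u] step.IH] by metis
  then show ?case by (simp only: distrib_right[symmetric]) simp
qed simp

lemma convergent_root_iterate: "convergent (\<lambda>n. root_iterate X n u)"
proof -
  obtain l where l: "root_majorant \<longlonglongrightarrow> l"
    using incseq_convergent[OF incseq_root_majorant] root_majorant_bounds(2) by blast
  have lim: "(\<lambda>n. (root_majorant n) * norm u) \<longlonglongrightarrow> l * norm u" by (intro tendsto_intros l)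
  have "Cauchy (\<lambda>n. root_iterate X n u)"
  proof (rule CauchyI')
    fix e :: real assume "0 < e"
    then obtain N where N: "\<And>m n. m \<ge> N \<Longrightarrow> n \<ge> N \<Longrightarrow>
        norm (root_majorant m * norm u - root_majorant n * norm u) < e"
      using CauchyD[OF LIMSEQ_imp_Cauchy[OF lim]] by blast
    show "\<exists>N. \<forall>m\<ge>N. \<forall>n>m. dist (root_iterate X m u) (root_iterate X n u) < e"
    proof (intro exI allI impI)
      fix m n assume mn: "N \<le> m" "m < n"
      have "dist (root_iterate X m u) (root_iterate X n u) \<le> (root_majorant n - root_majorant m) * norm u"
        using norm_root_iterate_diff_le[of m n u] mn by (simp add: dist_norm norm_minus_commute)
      also have "\<dots> < e" using N[of n m] mn by (simp add: left_diff_distrib)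
      finally show "dist (root_iterate X m u) (root_iterate X n u) < e" .
    qed
  qed
  then show ?thesis by (rule Cauchy_convergent)
qed

text \<open>\<open>Y\<close> is the strong limit of the iterates, and \<open>1 - Y\<close> is the root of \<open>1 - X\<close>. The last
  clause gives the commuting roots that are needed for an operator and its complement.\<close>

lemma square_root_of_complement:
  obtains Y where "symmetric_contraction Y" "\<And>u. Y (Y u) = 2 *\<^sub>R Y u - X u"
    "\<And>Z u. symmetric_contraction Z \<Longrightarrow> (\<And>v. Z (X v) = X (Z v)) \<Longrightarrow> Z (Y u) = Y (Z u)"
proof
  define Y where "Y u = lim (\<lambda>n. root_iterate X n u)" for u
  have lim: "(\<lambda>n. root_iterate X n u) \<longlonglongrightarrow> Y u" for u
    using convergent_root_iterate[of u] by (simp add: Y_def convergent_LIMSEQ_iff)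
  show Y: "symmetric_contraction Y"
    unfolding symmetric_contraction_def symmetric_map_def
  proof (intro conjI allI)
    fix x y
    have "(\<lambda>n. cinner (root_iterate X n x) y) \<longlonglongrightarrow> cinner (Y x) y"
      by (intro tendsto_intros lim)
    moreover have "(\<lambda>n. cinner x (root_iterate X n y)) \<longlonglongrightarrow> cinner x (Y y)"
      by (intro tendsto_intros lim)
    ultimately show "cinner (Y x) y = cinner x (Y y)"
      by (simp add: symmetric_map_swap[OF symmetric_map_root_iterate] LIMSEQ_unique)
    show "norm (Y x) \<le> norm x"
      using symmetric_contraction_root_iterate
      by (intro LIMSEQ_le_const2[OF tendsto_norm[OF lim]]) (auto simp: symmetric_contraction_def)
  qed
  show "Y (Y u) = 2 *\<^sub>R Y u - X u" for u
  proof -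
    \<comment> \<open>the iterates are contractions, so they may be composed in the limit\<close>
    have "(\<lambda>n. root_iterate X n (root_iterate X n u - Y u)) \<longlonglongrightarrow> 0"
    proof (rule Lim_null_comparison)
      show "\<forall>\<^sub>F n in sequentially. norm (root_iterate X n (root_iterate X n u - Y u)) \<le> norm (root_iterate X n u - Y u)"
        using symmetric_contraction_root_iterate by (simp add: symmetric_contraction_def)
      show "(\<lambda>n. norm (root_iterate X n u - Y u)) \<longlonglongrightarrow> 0"
        using lim[of u] by (simp add: LIM_zero_iff tendsto_norm_zero_iff)
    qed
    from tendsto_add[OF this lim[of "Y u"]]
    have "(\<lambda>n. root_iterate X n (root_iterate X n u)) \<longlonglongrightarrow> Y (Y u)"
      by (simp add: symmetric_map_diff[OF symmetric_map_root_iterate])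
    then have "(\<lambda>n. root_iterate X (Suc n) u) \<longlonglongrightarrow> (1/2) *\<^sub>R (X u + Y (Y u))"
      by (simp only: root_iterate.simps) (intro tendsto_intros)
    then have "Y u = (1/2) *\<^sub>R (X u + Y (Y u))"
      using LIMSEQ_Suc[OF lim[of u]] LIMSEQ_unique by blast
    then have "2 *\<^sub>R Y u = 2 *\<^sub>R (1/2) *\<^sub>R (X u + Y (Y u))" by (rule arg_cong)
    then show ?thesis by simp
  qed
  show "Z (Y u) = Y (Z u)" if Z: "symmetric_contraction Z" and ZX: "\<And>v. Z (X v) = X (Z v)" for Z u
  proof -
    have "Z (root_iterate X n v) = root_iterate X n (Z v)" for n v
      using Z by (induction n arbitrary: v)
        (simp_all add: ZX symmetric_contraction_def symmetric_map_zero symmetric_map_add symmetric_map_scaleR)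
    then show ?thesis
      using LIMSEQ_unique[OF symmetric_contraction_tendsto[OF Z lim[of u]]] lim[of "Z u"] by simp
  qed
qed

end

text \<open>The roots \<open>a\<close> of \<open>1 - B\<close> and \<open>b\<close> of \<open>B\<close> commute because each is a limit of polynomials in
  \<open>B\<close>. Positivity of the product \<open>a b\<close> needs one more root: with \<open>b = c\<^sup>2\<close> and \<open>c\<close> commuting with \<open>a\<close>,
  \<open>\<langle>a u|b u\<rangle> = \<langle>a (c u)|c u\<rangle> \<ge> 0\<close>.\<close>

lemma complementary_square_roots:
  fixes B :: "'h::complex_hilbert \<Rightarrow> 'h"
  assumes B: "symmetric_contraction B" and B': "symmetric_contraction (\<lambda>u. u - B u)"
  obtains a b where "symmetric_map a" "symmetric_map b"
    "\<And>u. a (a u) = u - B u" "\<And>u. b (b u) = B u" "\<And>u. a (b u) = b (a u)"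
    "\<And>u. cinner (a u) (b u) \<in> \<real>\<^sub>\<ge>\<^sub>0"
proof -
  obtain Y where Y: "symmetric_contraction Y" "\<And>u. Y (Y u) = 2 *\<^sub>R Y u - B u"
    "\<And>Z u. symmetric_contraction Z \<Longrightarrow> (\<And>v. Z (B v) = B (Z v)) \<Longrightarrow> Z (Y u) = Y (Z u)"
    using square_root_of_complement[OF B] by blast
  obtain Z where Z: "symmetric_contraction Z" "\<And>u. Z (Z u) = 2 *\<^sub>R Z u - (u - B u)"
    "\<And>C u. symmetric_contraction C \<Longrightarrow> (\<And>v. C (v - B v) = C v - B (C v)) \<Longrightarrow> C (Z u) = Z (C u)"
    using square_root_of_complement[OF B'] by blast
  obtain W where W: "symmetric_contraction W" "\<And>u. W (W u) = 2 *\<^sub>R W u - Z u"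
    "\<And>C u. symmetric_contraction C \<Longrightarrow> (\<And>v. C (Z v) = Z (C v)) \<Longrightarrow> C (W u) = W (C u)"
    using square_root_of_complement[OF Z(1)] by blast
  have sym: "symmetric_map Y" "symmetric_map Z" "symmetric_map W" "symmetric_map B"
    using Y(1) Z(1) W(1) B by (simp_all add: symmetric_contraction_def)
  have BY: "B (Y u) = Y (B u)" for u by (rule Y(3)[OF B]) simp
  have YZ: "Y (Z u) = Z (Y u)" for u by (rule Z(3)[OF Y(1)]) (simp add: BY symmetric_map_diff[OF sym(1)])
  have YW: "Y (W u) = W (Y u)" for u by (rule W(3)[OF Y(1)]) (simp add: YZ)
  define a b c where "a u = u - Y u" and "b u = u - Z u" and "c u = u - W u" for u
  have ab: "symmetric_map a" "symmetric_map b" and c: "symmetric_map c"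
    using sym by (simp_all add: symmetric_map_def a_def b_def c_def cinner_diff_left cinner_diff_right)
  have aa: "a (a u) = u - B u" for u
    by (simp add: a_def symmetric_map_diff[OF sym(1)] Y(2) scaleR_2)
  have bb: "b (b u) = B u" for u
    by (simp add: b_def symmetric_map_diff[OF sym(2)] Z(2) scaleR_2)
  have cc: "c (c u) = b u" for u
    by (simp add: b_def c_def symmetric_map_diff[OF sym(3)] W(2) scaleR_2)
  have comm: "a (b u) = b (a u)" for u
    by (simp add: a_def b_def symmetric_map_diff[OF sym(1)] symmetric_map_diff[OF sym(2)] YZ)
  have ac: "c (a u) = a (c u)" for u
    by (simp add: a_def c_def symmetric_map_diff[OF sym(1)] symmetric_map_diff[OF sym(3)] YW)
  have a_pos: "cinner (a u) u \<in> \<real>\<^sub>\<ge>\<^sub>0" for u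
  proof -
    have "cinner (a u) u = cnj (cinner (a u) u)"
      using symmetric_map_swap[OF ab(1)] cinner_commute by metis
    then have "Im (cinner (a u) u) = 0" by (simp add: complex_eq_iff)
    moreover have "Re (cinner (Y u) u) \<le> norm u * norm u"
      using complex_Re_le_cmod[of "cinner (Y u) u"] norm_cinner_le[of "Y u" u] Y(1)
        mult_right_mono[of "norm (Y u)" "norm u" "norm u"]
      by (auto simp: symmetric_contraction_def intro: order_trans)
    then have "0 \<le> Re (cinner (a u) u)"
      by (simp add: a_def cinner_diff_left power2_norm_eq_cinner[symmetric] power2_eq_square)
    ultimately show ?thesis by (simp add: complex_nonneg_Reals_iff)
  qed
  have "cinner (a u) (b u) = cinner (a (c u)) (c u)" for u
    using cc[of u] symmetric_map_swap[OF c, of "a u" "c u"] ac[of u] by simp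
  then have "cinner (a u) (b u) \<in> \<real>\<^sub>\<ge>\<^sub>0" for u using a_pos by simp
  then show ?thesis using that[OF ab aa bb comm] by blast
qed


section \<open>Unbounded self-adjoint operators\<close>

text \<open>Operators are handled through their graphs \<open>{(f, h). A f = Some h}\<close>; in this form linearity
  and self-adjointness can be used without mentioning \<^const>\<open>the\<close> and \<^const>\<open>dom\<close>.\<close>

lemma linear_operator_iff:
  "linear_operator A \<longleftrightarrow> A 0 = Some 0 \<and>
    (\<forall>f g h k. A f = Some h \<longrightarrow> A g = Some k \<longrightarrow> A (f + g) = Some (h + k)) \<and>
    (\<forall>c f h. A f = Some h \<longrightarrow> A (scaleC c f) = Some (scaleC c h))"
proof
  assume A: "linear_operator A"
  then have add: "A f = Some h \<Longrightarrow> A g = Some k \<Longrightarrow> A (f + g) = Some (h + k)" for f g h k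
    unfolding linear_operator_def by (metis domD domI option.sel)
  moreover have "A f = Some h \<Longrightarrow> A (scaleC c f) = Some (scaleC c h)" for f h c
    using A unfolding linear_operator_def by (metis domD domI option.sel)
  moreover obtain z where "A 0 = Some z" using A unfolding linear_operator_def by blast
  then have "A 0 = Some 0" using add[of 0 z 0 z] by simp
  ultimately show "A 0 = Some 0 \<and>
    (\<forall>f g h k. A f = Some h \<longrightarrow> A g = Some k \<longrightarrow> A (f + g) = Some (h + k)) \<and>
    (\<forall>c f h. A f = Some h \<longrightarrow> A (scaleC c f) = Some (scaleC c h))" by blast
next
  assume "A 0 = Some 0 \<and>
    (\<forall>f g h k. A f = Some h \<longrightarrow> A g = Some k \<longrightarrow> A (f + g) = Some (h + k)) \<and>
    (\<forall>c f h. A f = Some h \<longrightarrow> A (scaleC c f) = Some (scaleC c h))"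
  then show "linear_operator A"
    unfolding linear_operator_def dom_def by auto
qed

lemma adjoint_operator_iff:
  assumes "densely_defined A"
  shows "adjoint_operator A g = Some h \<longleftrightarrow> (\<forall>f k. A f = Some k \<longrightarrow> cinner k g = cinner f h)"
proof -
  have *: "(\<forall>f\<in>dom A. cinner (the (A f)) g = cinner f x) \<longleftrightarrow>
      (\<forall>f k. A f = Some k \<longrightarrow> cinner k g = cinner f x)" for x
    by force
  have unique: "x = y" if "\<forall>f k. A f = Some k \<longrightarrow> cinner k g = cinner f x"
    "\<forall>f k. A f = Some k \<longrightarrow> cinner k g = cinner f y" for x y
  proof (rule eq_of_cinner_eq_on_dense)
    show "closure (dom A) = UNIV" using assms by (simp add: densely_defined_def)
    fix z assume "z \<in> dom A"
    then have "cinner z x = cinner z y" using that by (metis domD)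
    then show "cinner x z = cinner y z" by (metis cinner_commute)
  qed
  show ?thesis
  proof
    assume "adjoint_operator A g = Some h"
    then have ex: "\<exists>x. \<forall>f k. A f = Some k \<longrightarrow> cinner k g = cinner f x"
      and h: "h = (THE x. \<forall>f k. A f = Some k \<longrightarrow> cinner k g = cinner f x)"
      unfolding adjoint_operator_def * by (auto split: if_splits)
    show "\<forall>f k. A f = Some k \<longrightarrow> cinner k g = cinner f h"
      unfolding h by (rule theI') (use ex unique in blast)
  next
    assume h: "\<forall>f k. A f = Some k \<longrightarrow> cinner k g = cinner f h"
    then have "(THE x. \<forall>f k. A f = Some k \<longrightarrow> cinner k g = cinner f x) = h"
      using unique by (intro the_equality) auto
    then show "adjoint_operator A g = Some h"
      using h unfolding adjoint_operator_def * by auto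
  qed
qed

lemma map_eqI: "(\<And>x y. A x = Some y \<longleftrightarrow> B x = Some y) \<Longrightarrow> A = B"
  by (rule ext) (metis option.exhaust)

lemma self_adjoint_iff:
  "self_adjoint A \<longleftrightarrow> linear_operator A \<and> densely_defined A \<and>
    (\<forall>g h. A g = Some h \<longleftrightarrow> (\<forall>f k. A f = Some k \<longrightarrow> cinner k g = cinner f h))"
proof (cases "densely_defined A")
  case True
  have "adjoint_operator A = A \<longleftrightarrow> (\<forall>g h. A g = Some h \<longleftrightarrow> adjoint_operator A g = Some h)"
    using map_eqI[of A "adjoint_operator A"] by auto
  then show ?thesis
    unfolding self_adjoint_def adjoint_operator_iff[OF True] by simp
qed (simp add: self_adjoint_def)

lemma linear_operator_diff:
  assumes "linear_operator A" "A f = Some h" "A g = Some k"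
  shows "A (f - g) = Some (h - k)"
proof -
  have "A (f + scaleC (-1) g) = Some (h + scaleC (-1) k)"
    using assms unfolding linear_operator_iff by blast
  then show ?thesis by (simp add: scaleC_minus_one)
qed

lemma linear_operator_scaleR:
  "linear_operator A \<Longrightarrow> A f = Some h \<Longrightarrow> A (r *\<^sub>R f) = Some (r *\<^sub>R h)"
  unfolding linear_operator_iff by (metis scaleC_of_real)

lemma self_adjoint_symmetric:
  "self_adjoint A \<Longrightarrow> A f = Some h \<Longrightarrow> A g = Some k \<Longrightarrow> cinner h g = cinner f k"
  unfolding self_adjoint_iff by blast

lemma self_adjointD:
  "self_adjoint A \<Longrightarrow> (\<And>f k. A f = Some k \<Longrightarrow> cinner k g = cinner f h) \<Longrightarrow> A g = Some h"
  unfolding self_adjoint_iff by blast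

lemma self_adjoint_closed:
  assumes A: "self_adjoint A" and X: "\<And>n::nat. A (X n) = Some (Y n)"
    and f: "X \<longlonglongrightarrow> f" and h: "Y \<longlonglongrightarrow> h"
  shows "A f = Some h"
proof (rule self_adjointD[OF A])
  fix g k assume g: "A g = Some k"
  have "(\<lambda>n. cinner k (X n)) \<longlonglongrightarrow> cinner k f" by (intro tendsto_intros f)
  moreover have "(\<lambda>n. cinner g (Y n)) \<longlonglongrightarrow> cinner g h" by (intro tendsto_intros h)
  ultimately show "cinner k f = cinner g h"
    using self_adjoint_symmetric[OF A g X] by (simp add: LIMSEQ_unique)
qed

lemma mem_ran_iff: "y \<in> ran A \<longleftrightarrow> (\<exists>x. A x = Some y)"
  by (auto simp: ran_def)

text \<open>A vector orthogonal to the range lies in the domain of the adjoint and is mapped to \<open>0\<close> by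
  it.\<close>

lemma self_adjoint_range_dense:
  assumes A: "self_adjoint A" and inj: "\<And>f. A f = Some 0 \<Longrightarrow> f = 0"
  shows "closure (ran A) = UNIV"
proof (rule dense_if_orthogonal_complement_trivial)
  have lin: "linear_operator A" using A by (simp add: self_adjoint_iff)
  then show "0 \<in> ran A" "\<And>f g. f \<in> ran A \<Longrightarrow> g \<in> ran A \<Longrightarrow> f + g \<in> ran A"
    "\<And>c f. f \<in> ran A \<Longrightarrow> scaleC c f \<in> ran A"
    unfolding linear_operator_iff mem_ran_iff by blast+
  fix u assume u: "\<And>g. g \<in> ran A \<Longrightarrow> cinner u g = 0"
  show "u = 0"
  proof (rule inj, rule self_adjointD[OF A])
    fix f k assume "A f = Some k"
    then have "cinner u k = 0" by (intro u) (auto simp: mem_ran_iff)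
    then show "cinner k u = cinner f 0" using cinner_commute[of k u] by simp
  qed
qed

text \<open>Boundedness below makes the range of a closed operator closed, and it is dense already.\<close>

lemma self_adjoint_range_UNIV:
  assumes A: "self_adjoint A" and bound: "\<And>f h. A f = Some h \<Longrightarrow> norm f \<le> K * norm h"
  shows "ran A = UNIV"
proof (intro set_eqI iffI UNIV_I)
  fix g
  have lin: "linear_operator A" using A by (simp add: self_adjoint_iff)
  have "closure (ran A) = UNIV"
    by (rule self_adjoint_range_dense[OF A]) (use bound in fastforce)
  then have "g \<in> closure (ran A)" by simp
  then obtain Y where "\<And>n. Y n \<in> ran A" and Y: "Y \<longlonglongrightarrow> g"
    unfolding closure_sequential by blast
  then obtain X where X: "\<And>n. A (X n) = Some (Y n)" unfolding mem_ran_iff by metis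
  have bound': "norm (X m - X n) \<le> \<bar>K\<bar> * norm (Y m - Y n)" for m n
    using bound[OF linear_operator_diff[OF lin X X]] mult_right_mono[OF abs_ge_self[of K]] norm_ge_zero
      order_trans by blast
  have "Cauchy X"
  proof (rule CauchyI)
    fix e :: real assume "0 < e"
    then have "0 < e / (\<bar>K\<bar> + 1)" by simp
    then obtain N where N: "\<And>m n. N \<le> m \<Longrightarrow> N \<le> n \<Longrightarrow> norm (Y m - Y n) < e / (\<bar>K\<bar> + 1)"
      using CauchyD[OF LIMSEQ_imp_Cauchy[OF Y]] by blast
    show "\<exists>N. \<forall>m\<ge>N. \<forall>n\<ge>N. norm (X m - X n) < e"
    proof (intro exI allI impI)
      fix m n assume "N \<le> m" "N \<le> n"
      then have "(\<bar>K\<bar> + 1) * norm (Y m - Y n) < e"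
        using N by (simp add: pos_less_divide_eq mult.commute)
      moreover have "\<bar>K\<bar> * norm (Y m - Y n) \<le> (\<bar>K\<bar> + 1) * norm (Y m - Y n)"
        by (intro mult_right_mono) auto
      ultimately show "norm (X m - X n) < e" using bound'[of m n] by linarith
    qed
  qed
  then obtain f where "X \<longlonglongrightarrow> f" using Cauchy_convergent convergent_def by blast
  then have "A f = Some g" using self_adjoint_closed[OF A X _ Y] by blast
  then show "g \<in> ran A" by (auto simp: mem_ran_iff)
qed

lemma inverse_operator_iff:
  assumes "linear_operator A" and inj: "\<And>f. A f = Some 0 \<Longrightarrow> f = 0"
  shows "inverse_operator A h = Some f \<longleftrightarrow> A f = Some h"
proof -
  have unique: "f = g" if "A f = Some h" "A g = Some h" for f g
    using inj[of "f - g"] linear_operator_diff[OF assms(1) that] by simp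
  show ?thesis
  proof
    assume "inverse_operator A h = Some f"
    then have "h \<in> ran A" and f: "f = (THE f. A f = Some h)"
      by (auto simp: inverse_operator_def split: if_splits)
    then obtain g where "A g = Some h" by (auto simp: mem_ran_iff)
    then show "A f = Some h" unfolding f by (intro theI'[of "\<lambda>f. A f = Some h"]) (use unique in blast)
  next
    assume f: "A f = Some h"
    then have "(THE f. A f = Some h) = f" using unique by (intro the_equality) auto
    then show "inverse_operator A h = Some f" using f by (auto simp: inverse_operator_def mem_ran_iff)
  qed
qed

lemma metric_operator_injective:
  assumes "metric_operator G" "G f = Some 0"
  shows "f = 0"
  using assms unfolding metric_operator_def by (metis cinner_zero_left domI option.sel)

text \<open>The graph of the inverse is the reflected graph, and the graph description of
  self-adjointness is symmetric under reflection. Strict positivity comes from the Cauchy--Schwarz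
  inequality for the form \<open>\<langle>Sf|g\<rangle>\<close>: if \<open>\<langle>Sf|f\<rangle> = 0\<close> then \<open>Sf\<close> is orthogonal to the dense domain of
  \<open>S\<close>.\<close>

lemma metric_operator_inverse:
  assumes S: "self_adjoint S" and pos: "nonneg_operator S" and inj: "\<And>f. S f = Some 0 \<Longrightarrow> f = 0"
  shows "metric_operator (inverse_operator S)"
proof -
  have lin: "linear_operator S" and dense: "densely_defined S" using S by (simp_all add: self_adjoint_iff)
  have inv: "inverse_operator S h = Some f \<longleftrightarrow> S f = Some h" for f h
    using inverse_operator_iff[OF lin] inj by blast
  have dom_inv: "dom (inverse_operator S) = ran S" by (auto simp: dom_def mem_ran_iff inv)
  have self: "self_adjoint (inverse_operator S)"
    unfolding self_adjoint_iff
  proof (intro conjI allI)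
    show "linear_operator (inverse_operator S)"
      using lin unfolding linear_operator_iff inv by blast
    show "densely_defined (inverse_operator S)"
      using self_adjoint_range_dense[OF S] inj by (simp add: densely_defined_def dom_inv)
    fix g h
    have "S h = Some g \<longleftrightarrow> (\<forall>f k. S f = Some k \<longrightarrow> cinner k h = cinner f g)"
      using S unfolding self_adjoint_iff by blast
    then show "inverse_operator S g = Some h \<longleftrightarrow>
        (\<forall>f k. inverse_operator S f = Some k \<longrightarrow> cinner k g = cinner f h)"
      unfolding inv by metis
  qed
  have nonneg: "cinner h f \<in> \<real>\<^sub>\<ge>\<^sub>0" if "S f = Some h" for f h
    using pos that unfolding nonneg_operator_def by (metis domI option.sel)
  interpret nonneg_form "dom S" "\<lambda>f g. cinner (the (S f)) g"
  proof
    fix f g assume "f \<in> dom S" "g \<in> dom S"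
    then show "cinner (the (S f)) g = cnj (cinner (the (S g)) f)"
      using self_adjoint_symmetric[OF S] cinner_commute by (metis domD option.sel)
  next
    fix f assume "f \<in> dom S"
    then show "0 \<le> Re (cinner (the (S f)) f)"
      using nonneg by (metis complex_nonneg_Reals_iff domD option.sel)
  qed (use lin in \<open>auto simp: linear_operator_def cinner_add_left cinner_scaleC_left\<close>)
  have definite: "f = 0" if f: "S f = Some h" and 0: "cinner h f = 0" for f h
  proof -
    have "h = 0"
    proof (rule eq_of_cinner_eq_on_dense)
      show "closure (dom S) = UNIV" using dense by (simp add: densely_defined_def)
      fix g assume "g \<in> dom S"
      then show "cinner h g = cinner 0 g"
        using form_eq_0_of_quadratic_eq_0[of f g] f 0 by (auto simp: domI)
    qed
    then show ?thesis using inj f by blast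
  qed
  have sym: "cinner f h = cinner h f" if "S f = Some h" for f h
    using self_adjoint_symmetric[OF S that that] by simp
  show ?thesis
    unfolding metric_operator_def nonneg_operator_def
  proof (intro conjI self ballI)
    fix h assume "h \<in> dom (inverse_operator S)"
    then obtain f where fi: "inverse_operator S h = Some f" by blast
    then have f: "S f = Some h" by (simp add: inv)
    then show "cinner (the (inverse_operator S h)) h \<in> \<real>\<^sub>\<ge>\<^sub>0"
      using nonneg[OF f] sym[OF f] fi by simp
    have "h = 0" if "f = 0" using f that lin unfolding linear_operator_iff by simp
    then show "cinner (the (inverse_operator S h)) h = 0 \<longleftrightarrow> h = 0"
      using definite[OF f] sym[OF f] fi by auto
  qed
qed

lemma map_comp_eq_Some_iff: "(B \<circ>\<^sub>m A) x = Some z \<longleftrightarrow> (\<exists>y. A x = Some y \<and> B y = Some z)"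
  by (auto simp: map_comp_def split: option.splits)

text \<open>The assumption on \<open>T\<close> says \<open>B = (1 + T)\<^sup>-\<^sup>1\<close>. With \<open>a\<^sup>2 = 1 - B\<close> and \<open>b\<^sup>2 = B\<close> the root of
  \<open>T = (1 - B) B\<^sup>-\<^sup>1\<close> ought to be \<open>a b\<^sup>-\<^sup>1\<close>, that is, \<open>b u \<mapsto> a u\<close>. The whole proof hinges on one trick:
  since \<open>a\<close> and \<open>b\<close> commute and \<open>a\<^sup>2 + b\<^sup>2 = 1\<close>, any solution of \<open>a u = b v\<close> has the form \<open>u = b w\<close>,
  \<open>v = a w\<close> with \<open>w = b u + a v\<close>. It yields self-adjointness (for \<open>a g = b h\<close> says that \<open>(g, h)\<close> is in the graph
  of the adjoint) and the domain of the square (where \<open>a u = b v\<close> expresses that \<open>S\<close> can be applied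
  twice).\<close>

theorem square_root_of_resolvent_generator:
  fixes T :: "'h::complex_hilbert \<rightharpoonup> 'h"
  assumes B: "symmetric_contraction B" and B': "symmetric_contraction (\<lambda>u. u - B u)"
    and inj: "inj B" and dense: "closure (range B) = UNIV"
    and T: "\<And>f h. T f = Some h \<longleftrightarrow> f = B (f + h)"
  obtains S where "self_adjoint S" "nonneg_operator S" "S \<circ>\<^sub>m S = T"
proof -
  obtain a b where sym: "symmetric_map a" "symmetric_map b"
    and aa: "\<And>u. a (a u) = u - B u" and bb: "\<And>u. b (b u) = B u"
    and ab: "\<And>u. a (b u) = b (a u)" and pos: "\<And>u. cinner (a u) (b u) \<in> \<real>\<^sub>\<ge>\<^sub>0"
    using complementary_square_roots[OF B B'] by blast
  have inj_b: "inj b" using inj by (metis bb injD injI)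
  define S where "S = (\<lambda>f. if f \<in> range b then Some (a (inv b f)) else None)"
  have S: "S f = Some h \<longleftrightarrow> (\<exists>u. f = b u \<and> h = a u)" for f h
    unfolding S_def using inj_b by (auto simp: inv_f_f)
  have dom_S: "dom S = range b" by (auto simp: S_def dom_def)
  have recover: "b (b u + a v) = u \<and> a (b u + a v) = v" if "a u = b v" for u v
    using that aa[of u] aa[of v] bb[of u] bb[of v] ab[of u] ab[of v]
    by (simp add: symmetric_map_add[OF sym(1)] symmetric_map_add[OF sym(2)])
  have "self_adjoint S"
    unfolding self_adjoint_iff
  proof (intro conjI allI iffI impI)
    show "linear_operator S"
      unfolding linear_operator_iff S
    proof (intro conjI allI impI)
      show "\<exists>u. 0 = b u \<and> 0 = a u"
        using sym by (intro exI[of _ 0]) (simp add: symmetric_map_zero)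
      show "\<exists>w. f + g = b w \<and> h + k = a w"
        if "\<exists>u. f = b u \<and> h = a u" "\<exists>v. g = b v \<and> k = a v" for f g h k
        using that symmetric_map_add[OF sym(1)] symmetric_map_add[OF sym(2)] by metis
      show "\<exists>w. scaleC c f = b w \<and> scaleC c h = a w" if "\<exists>u. f = b u \<and> h = a u" for c f h
        using that symmetric_map_scaleC[OF sym(1)] symmetric_map_scaleC[OF sym(2)] by metis
    qed
    have "range B \<subseteq> range b" by (auto simp flip: bb)
    then show "densely_defined S"
      unfolding densely_defined_def dom_S using closure_mono dense by blast
    fix g h
    show "cinner k g = cinner f h" if "S g = Some h" "S f = Some k" for f k
      using that unfolding S by (metis sym ab symmetric_map_swap)
    assume "\<forall>f k. S f = Some k \<longrightarrow> cinner k g = cinner f h"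
    then have "cinner (a u) g = cinner (b u) h" for u unfolding S by blast
    then have "a g = b h"
      using cinner_eqI[of "a g" "b h"] cinner_commute symmetric_map_swap[OF sym(1)]
        symmetric_map_swap[OF sym(2)] by metis
    then show "S g = Some h" unfolding S using recover by metis
  qed
  moreover have "nonneg_operator S"
    unfolding nonneg_operator_def
  proof
    fix f assume "f \<in> dom S"
    then obtain h where h: "S f = Some h" by blast
    then obtain u where "f = b u" "h = a u" unfolding S by blast
    then show "cinner (the (S f)) f \<in> \<real>\<^sub>\<ge>\<^sub>0" using pos h by simp
  qed
  moreover have "S \<circ>\<^sub>m S = T"
  proof (rule map_eqI)
    fix f k
    show "(S \<circ>\<^sub>m S) f = Some k \<longleftrightarrow> T f = Some k"
      unfolding map_comp_eq_Some_iff S T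
    proof
      assume "\<exists>h. (\<exists>u. f = b u \<and> h = a u) \<and> (\<exists>v. h = b v \<and> k = a v)"
      then obtain u v where "f = b u" "a u = b v" "k = a v" by blast
      then show "f = B (f + k)" using recover[of u v] bb[of "b u + a v"] by simp
    next
      assume f: "f = B (f + k)"
      then have "f = b (b (f + k))" "k = a (a (f + k))"
        using aa[of "f + k"] bb[of "f + k"] by simp_all
      then show "\<exists>h. (\<exists>u. f = b u \<and> h = a u) \<and> (\<exists>v. h = b v \<and> k = a v)"
        using ab by metis
    qed
  qed
  ultimately show ?thesis using that by blast
qed


section \<open>The operator of a densely defined closed form\<close>

locale dense_closed_form = closed_form +
  assumes dense: "closure V = UNIV"
begin

text \<open>The operator of Kato's first representation theorem.\<close>

definition form_operator :: "'a \<rightharpoonup> 'a" where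
  "form_operator f = (if f \<in> V \<and> (\<exists>h. \<forall>g\<in>V. E f g = cinner h g)
     then Some (THE h. \<forall>g\<in>V. E f g = cinner h g) else None)"

lemma form_operator_iff: "form_operator f = Some h \<longleftrightarrow> f \<in> V \<and> (\<forall>g\<in>V. E f g = cinner h g)"
proof -
  have unique: "h = k" if "\<forall>g\<in>V. E f g = cinner h g" "\<forall>g\<in>V. E f g = cinner k g" for h k
    using that by (intro eq_of_cinner_eq_on_dense[OF dense]) simp
  show ?thesis
  proof
    assume "form_operator f = Some h"
    then have f: "f \<in> V" and ex: "\<exists>h. \<forall>g\<in>V. E f g = cinner h g"
      and h: "h = (THE h. \<forall>g\<in>V. E f g = cinner h g)"
      by (auto simp: form_operator_def split: if_splits)
    have "\<forall>g\<in>V. E f g = cinner h g" unfolding h by (rule theI') (use ex unique in blast)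
    with f show "f \<in> V \<and> (\<forall>g\<in>V. E f g = cinner h g)" by blast
  next
    assume h: "f \<in> V \<and> (\<forall>g\<in>V. E f g = cinner h g)"
    then have "(THE h. \<forall>g\<in>V. E f g = cinner h g) = h" by (intro the_equality) (use unique in blast)+
    then show "form_operator f = Some h" unfolding form_operator_def using h by auto
  qed
qed

text \<open>The operator \<open>(1 + t T)\<^sup>-\<^sup>1\<close>, where \<open>T\<close> is the operator of the form. All \<open>t > 0\<close> are needed:
  \<open>t = 1\<close> constructs the square root of \<open>T\<close>, and \<open>t \<rightarrow> 0\<close> approximates vectors by elements of the domain
  of \<open>T\<close>.\<close>

definition resolvent :: "real \<Rightarrow> 'a \<Rightarrow> 'a" where
  "resolvent t u = (SOME f. f \<in> V \<and> (\<forall>g\<in>V. cinner f g + of_real t * E f g = cinner u g))"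

context
  fixes t :: real
  assumes t: "0 < t"
begin

lemma resolvent_mem: "resolvent t u \<in> V"
  and resolvent_eq: "g \<in> V \<Longrightarrow> cinner (resolvent t u) g + of_real t * E (resolvent t u) g = cinner u g"
proof -
  have "\<exists>f. f \<in> V \<and> (\<forall>g\<in>V. cinner f g + of_real t * E f g = cinner u g)"
    by (rule resolvent_equation[OF t, of u]) blast
  from someI_ex[OF this] show "resolvent t u \<in> V"
    "g \<in> V \<Longrightarrow> cinner (resolvent t u) g + of_real t * E (resolvent t u) g = cinner u g"
    unfolding resolvent_def by blast+
qed

lemma resolvent_eqI:
  assumes f: "f \<in> V" and eq: "\<And>g. g \<in> V \<Longrightarrow> cinner f g + of_real t * E f g = cinner u g"
  shows "f = resolvent t u"
proof -
  define d where "d = f - resolvent t u"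
  have d: "d \<in> V" unfolding d_def by (intro diff_mem f resolvent_mem)
  have "cinner d d + of_real t * E d d = 0"
  proof -
    have "cinner d d = cinner f d - cinner (resolvent t u) d"
      unfolding d_def by (rule cinner_diff_left)
    moreover have "E d d = E f d - E (resolvent t u) d"
      using form_diff_left[OF f resolvent_mem[of u] d] by (simp only: d_def)
    ultimately show ?thesis using eq[OF d] resolvent_eq[OF d, of u] by algebra
  qed
  then have "Re (cinner d d + of_real t * E d d) = 0" by simp
  then have "(norm d)\<^sup>2 + t * Re (E d d) = 0" by (simp add: power2_norm_eq_cinner)
  moreover have "0 \<le> t * Re (E d d)" using t form_nonneg[OF d] by simp
  ultimately have "(norm d)\<^sup>2 \<le> 0" by linarith
  then show ?thesis by (simp add: d_def)
qed

lemma resolvent_iff: "f = resolvent t u \<longleftrightarrow> form_operator f = Some ((1/t) *\<^sub>R (u - f))"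
proof -
  have *: "E f g = cinner ((1/t) *\<^sub>R (u - f)) g \<longleftrightarrow> cinner f g + of_real t * E f g = cinner u g" for g
  proof -
    have c: "cinner ((1/t) *\<^sub>R (u - f)) g = (cinner u g - cinner f g) / of_real t"
      by (simp add: cinner_scaleR_left cinner_diff_left)
    have "E f g = cinner ((1/t) *\<^sub>R (u - f)) g \<longleftrightarrow> of_real t * E f g = cinner u g - cinner f g"
      unfolding c using t by (simp add: eq_divide_eq mult.commute)
    also have "\<dots> \<longleftrightarrow> cinner f g + of_real t * E f g = cinner u g"
      unfolding eq_diff_eq by (simp only: add.commute)
    finally show ?thesis .
  qed
  show ?thesis
    unfolding form_operator_iff *
    using resolvent_mem[of u] resolvent_eq[of _ u] resolvent_eqI[of f u] by blast
qed

lemma symmetric_map_resolvent: "symmetric_map (resolvent t)"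
  unfolding symmetric_map_def
proof (intro allI)
  fix u v
  have "cinner (resolvent t u) v = cnj (cinner v (resolvent t u))" by (rule cinner_commute)
  also have "\<dots> = cnj (cinner (resolvent t v) (resolvent t u)) + of_real t * cnj (E (resolvent t v) (resolvent t u))"
    using resolvent_eq[OF resolvent_mem[of u], of v] by (metis complex_cnj_add complex_cnj_complex_of_real complex_cnj_mult)
  also have "\<dots> = cinner (resolvent t u) (resolvent t v) + of_real t * E (resolvent t u) (resolvent t v)"
    using form_commute[OF resolvent_mem[of u] resolvent_mem[of v]] by (simp flip: cinner_commute)
  also have "\<dots> = cinner u (resolvent t v)" by (rule resolvent_eq[OF resolvent_mem])
  finally show "cinner (resolvent t u) v = cinner u (resolvent t v)" .
qed

lemma resolvent_energy:
  "(norm (resolvent t u))\<^sup>2 + t * Re (E (resolvent t u) (resolvent t u)) = Re (cinner u (resolvent t u))"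
  using arg_cong[OF resolvent_eq[OF resolvent_mem[of u], of u], of Re]
  by (simp add: power2_norm_eq_cinner)

lemma symmetric_contraction_resolvent: "symmetric_contraction (resolvent t)"
  unfolding symmetric_contraction_def
proof (intro conjI allI symmetric_map_resolvent)
  fix u
  have "(norm (resolvent t u))\<^sup>2 \<le> Re (cinner u (resolvent t u))"
    using resolvent_energy[of u] mult_nonneg_nonneg[OF less_imp_le[OF t] form_nonneg[OF resolvent_mem[of u]]]
    by linarith
  also have "\<dots> \<le> norm u * norm (resolvent t u)"
    using norm_cinner_le complex_Re_le_cmod order_trans by blast
  finally show "norm (resolvent t u) \<le> norm u"
    by (cases "resolvent t u = 0") (simp_all add: power2_eq_square)
qed

lemma symmetric_contraction_id_minus_resolvent: "symmetric_contraction (\<lambda>u. u - resolvent t u)"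
  unfolding symmetric_contraction_def
proof (intro conjI allI)
  show "symmetric_map (\<lambda>u. u - resolvent t u)"
    using symmetric_map_resolvent by (simp add: symmetric_map_def cinner_diff_left cinner_diff_right)
  fix u
  define f where "f = resolvent t u"
  have "(norm u)\<^sup>2 = (norm (u - f))\<^sup>2 + (norm f)\<^sup>2 + 2 * Re (cinner (u - f) f)"
    using power2_norm_add[of "u - f" f] by simp
  moreover have "Re (cinner (u - f) f) = t * Re (E f f)"
    using resolvent_energy[of u] by (simp add: f_def cinner_diff_left power2_norm_eq_cinner)
  moreover have "0 \<le> t * Re (E f f)" using t form_nonneg resolvent_mem by (simp add: f_def)
  ultimately have "(norm (u - f))\<^sup>2 \<le> (norm u)\<^sup>2" using zero_le_power2[of "norm f"] by linarith
  then show "norm (u - resolvent t u) \<le> norm u" by (simp add: f_def power2_le_iff_abs_le)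
qed

text \<open>\<open>u\<close> itself competes in the minimisation that defines the resolvent.\<close>

lemma resolvent_diff_le:
  assumes u: "u \<in> V"
  shows "(norm (resolvent t u - u))\<^sup>2 \<le> t * Re (E u u)"
proof -
  obtain f where f: "f \<in> V" "\<And>g. g \<in> V \<Longrightarrow> cinner f g + of_real t * E f g = cinner u g"
    "\<And>g. g \<in> V \<Longrightarrow> (norm (f - u))\<^sup>2 + t * Re (E f f) \<le> (norm (g - u))\<^sup>2 + t * Re (E g g)"
    by (rule resolvent_equation[OF t, of u]) blast
  have "0 \<le> t * Re (E f f)" using t form_nonneg[OF f(1)] by simp
  then have "(norm (f - u))\<^sup>2 \<le> t * Re (E u u)" using f(3)[OF u] by simp
  then show ?thesis using resolvent_eqI[OF f(1,2)] by simp
qed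

end

text \<open>On the form domain the previous estimate applies; contractivity extends the convergence to
  its closure.\<close>

lemma resolvent_tendsto:
  assumes "\<And>n. 0 < s n" and s: "s \<longlonglongrightarrow> 0"
  shows "(\<lambda>n. resolvent (s n) u) \<longlonglongrightarrow> u"
proof (rule LIMSEQ_I)
  fix e :: real assume e: "0 < e"
  obtain v where v: "v \<in> V" "dist v u < e / 3"
    using dense e closure_approachable[of u V] by (metis UNIV_I divide_pos_pos zero_less_numeral)
  have "(\<lambda>n. s n * Re (E v v)) \<longlonglongrightarrow> 0 * Re (E v v)" by (intro tendsto_intros s)
  then obtain N where N: "\<And>n. n \<ge> N \<Longrightarrow> s n * Re (E v v) < (e/3)\<^sup>2"
    using order_tendstoD(2)[of _ _ _ "(e/3)\<^sup>2"] e by (fastforce simp: eventually_sequentially)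
  show "\<exists>N. \<forall>n\<ge>N. norm (resolvent (s n) u - u) < e"
  proof (intro exI allI impI)
    fix n assume n: "N \<le> n"
    let ?R = "resolvent (s n)"
    have "(norm (?R v - v))\<^sup>2 < (e/3)\<^sup>2"
      using resolvent_diff_le[OF assms(1) v(1), of n] N[OF n] by simp
    then have 1: "norm (?R v - v) < e/3" by (rule power2_less_imp_less) (use e in simp)
    have 2: "norm (?R (u - v)) < e/3"
      using symmetric_contraction_resolvent[OF assms(1), of n] v(2)
      unfolding symmetric_contraction_def dist_norm by (metis norm_minus_commute order_le_less_trans)
    have "?R u - u = ?R (u - v) + (?R v - v) + (v - u)"
      by (simp add: symmetric_map_diff[OF symmetric_map_resolvent[OF assms(1)]])
    then have "norm (?R u - u) = norm (?R (u - v) + (?R v - v) + (v - u))" by (rule arg_cong)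
    moreover have "norm (v - u) < e/3" using v(2) by (simp add: dist_norm)
    ultimately show "norm (?R u - u) < e"
      using 1 2 norm_triangle_ineq[of "?R (u - v) + (?R v - v)" "v - u"]
        norm_triangle_ineq[of "?R (u - v)" "?R v - v"] by linarith
  qed
qed

lemma dom_form_operator:
  assumes "0 < t"
  shows "dom form_operator = range (resolvent t)"
proof (intro set_eqI iffI)
  fix f assume "f \<in> dom form_operator"
  then obtain h where h: "form_operator f = Some h" by blast
  have "f = resolvent t (f + t *\<^sub>R h)"
    unfolding resolvent_iff[OF assms] using h assms by simp
  then show "f \<in> range (resolvent t)" by blast
next
  fix f assume "f \<in> range (resolvent t)"
  then show "f \<in> dom form_operator" using resolvent_iff[OF assms] by blast
qed

lemma form_operator_densely_defined: "closure (dom form_operator) = UNIV"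
proof (intro set_eqI iffI UNIV_I)
  fix u
  have "\<forall>n. resolvent (1 / real (Suc n)) u \<in> dom form_operator"
    using dom_form_operator[of "1 / real (Suc n)" for n] by (metis of_nat_0_less_iff rangeI zero_less_Suc zero_less_divide_1_iff)
  moreover have "(\<lambda>n. resolvent (1 / real (Suc n)) u) \<longlonglongrightarrow> u"
    using LIMSEQ_inverse_real_of_nat by (intro resolvent_tendsto) (simp_all add: inverse_eq_divide)
  ultimately show "u \<in> closure (dom form_operator)"
    by (rule closure_sequential[THEN iffD2, OF exI, OF conjI])
qed

theorem form_operator_square_root:
  obtains S where "self_adjoint S" "nonneg_operator S" "S \<circ>\<^sub>m S = form_operator"
proof (rule square_root_of_resolvent_generator[of "resolvent 1" form_operator])
  show "symmetric_contraction (resolvent 1)" "symmetric_contraction (\<lambda>u. u - resolvent 1 u)"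
    by (simp_all add: symmetric_contraction_resolvent symmetric_contraction_id_minus_resolvent)
  show "inj (resolvent 1)"
  proof (rule injI)
    fix u v assume "resolvent 1 u = resolvent 1 v"
    then have "cinner u g = cinner v g" if "g \<in> V" for g
      using resolvent_eq[OF zero_less_one that, of u] resolvent_eq[OF zero_less_one that, of v] by simp
    then show "u = v" by (rule eq_of_cinner_eq_on_dense[OF dense])
  qed
  show "closure (range (resolvent 1)) = UNIV"
    using form_operator_densely_defined dom_form_operator[of 1] by simp
  show "form_operator f = Some h \<longleftrightarrow> f = resolvent 1 (f + h)" for f h
    unfolding resolvent_iff[OF zero_less_one] by simp
qed (use that in blast)

text \<open>The half of Kato's second representation theorem that concerns vectors in the domain of the
  root; \<open>S\<close> may be any self-adjoint operator with square \<open>T\<close>. The vectors \<open>R\<^sub>t f\<close> lie in the domain of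
  \<open>T\<close>, and \<open>S R\<^sub>t f = R\<^sub>t h\<close>. Lower semicontinuity gives \<open>\<Omega>(f, f) \<le> \<parallel>h\<parallel>\<^sup>2\<close>; the converse inequality comes from
  Cauchy--Schwarz applied to \<open>\<Omega>(R\<^sub>t f, f) = \<langle>R\<^sub>t h|h\<rangle>\<close>, which tends to \<open>\<parallel>h\<parallel>\<^sup>2\<close>.\<close>

theorem norm_square_root_eq_form:
  assumes S: "self_adjoint S" and root: "S \<circ>\<^sub>m S = form_operator" and f: "S f = Some h"
  shows "f \<in> V" and "Re (E f f) = (norm h)\<^sup>2"
proof -
  have lin: "linear_operator S" using S by (simp add: self_adjoint_iff)
  define s where "s n = 1 / real (Suc n)" for n
  define R where "R n = resolvent (s n)" for n
  have s: "0 < s n" for n by (simp add: s_def)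
  have "s \<longlonglongrightarrow> 0" using LIMSEQ_inverse_real_of_nat unfolding s_def by (simp add: inverse_eq_divide)
  then have R_lim: "(\<lambda>n. R n u) \<longlonglongrightarrow> u" for u unfolding R_def by (intro resolvent_tendsto s)
  have R_le: "norm (R n u) \<le> norm u" for n u
    using symmetric_contraction_resolvent[OF s] by (simp add: R_def symmetric_contraction_def)
  have key: "S (R n f) = Some (R n h)"
    "\<exists>k. S (R n h) = Some k \<and> (\<forall>g\<in>V. E (R n f) g = cinner k g)" for n
  proof -
    define k where "k = (1 / s n) *\<^sub>R (f - R n f)"
    have Tf: "form_operator (R n f) = Some k"
      using resolvent_iff[OF s, of "R n f" n f] by (simp add: R_def k_def)
    then obtain p where p: "S (R n f) = Some p" "S p = Some k"
      by (auto simp flip: root simp: map_comp_eq_Some_iff)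
    \<comment> \<open>\<open>S k\<close> is defined because \<open>k\<close> is a combination of \<open>f\<close> and \<open>R\<^sub>t f\<close>; this puts \<open>p\<close> in the domain of \<open>T\<close>\<close>
    have "S k = Some ((1 / s n) *\<^sub>R (h - p))"
      unfolding k_def by (intro linear_operator_scaleR[OF lin] linear_operator_diff[OF lin] f p)
    then have "form_operator p = Some ((1 / s n) *\<^sub>R (h - p))"
      using p by (auto simp flip: root simp: map_comp_eq_Some_iff)
    then have "p = R n h" using resolvent_iff[OF s, of p n h] by (simp add: R_def)
    then show "S (R n f) = Some (R n h)"
      "\<exists>k. S (R n h) = Some k \<and> (\<forall>g\<in>V. E (R n f) g = cinner k g)"
      using p Tf unfolding form_operator_iff by auto
  qed
  have RV: "R n f \<in> V" for n unfolding R_def by (rule resolvent_mem[OF s])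
  have E_R: "E (R n f) g = cinner (R n h) q" if "g \<in> V" "S g = Some q" for n g q
    using key(2)[of n] that self_adjoint_symmetric[OF S _ that(2)] by metis
  have Q_R: "Re (E (R n f) (R n f)) \<le> (norm h)\<^sup>2" for n
    using E_R[OF RV key(1)] R_le[of n h] by (simp add: cinner_self power_mono)
  have Q: "f \<in> V \<and> Re (E f f) \<le> (norm h)\<^sup>2"
    using RV R_lim Q_R by (rule lower_semicontinuous)
  then show fV: "f \<in> V" by blast
  have "(norm (cinner (R n h) h))\<^sup>2 \<le> (norm h)\<^sup>2 * Re (E f f)" for n
    using Cauchy_Schwarz[OF RV fV, of n] E_R[OF fV f, of n]
      mult_right_mono[OF Q_R[of n] form_nonneg[OF fV]] by simp
  moreover have "(\<lambda>n. (norm (cinner (R n h) h))\<^sup>2) \<longlonglongrightarrow> (norm (cinner h h))\<^sup>2"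
    by (intro tendsto_intros R_lim)
  ultimately have "(norm (cinner h h))\<^sup>2 \<le> (norm h)\<^sup>2 * Re (E f f)"
    by (intro LIMSEQ_le_const2) auto
  moreover have "norm (cinner h h) = (norm h)\<^sup>2"
    unfolding cinner_self norm_of_real by simp
  ultimately have le: "(norm h)\<^sup>2 * (norm h)\<^sup>2 \<le> (norm h)\<^sup>2 * Re (E f f)"
    by (simp only: power2_eq_square)
  have "(norm h)\<^sup>2 \<le> Re (E f f)"
  proof (cases "h = 0")
    case False
    then have "0 < (norm h)\<^sup>2" by simp
    with le show ?thesis by (simp only: mult_le_cancel_left_pos)
  qed (simp add: form_nonneg[OF fV])
  then show "Re (E f f) = (norm h)\<^sup>2" using Q by simp
qed

end

section \<open>The form of a weakly measurable mapping\<close>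

lemma cinner_right_eq: "cinner x y * cinner y z = cinner x y * cnj (cinner z (y::'h::complex_hilbert))"
  using cinner_commute[of y z] by simp

locale weakly_measurable_mapping =
  fixes M :: "'x measure" and \<phi> :: "'x \<Rightarrow> 'h::complex_hilbert"
  assumes weakly_measurable: "weakly_measurable M \<phi>"
begin

lemma measurable_coefficient [measurable]: "(\<lambda>x. cinner f (\<phi> x)) \<in> borel_measurable M"
  using weakly_measurable by (simp add: weakly_measurable_def)

lemma analysis_domain_iff:
  "f \<in> analysis_domain M \<phi> \<longleftrightarrow> integrable M (\<lambda>x. (norm (cinner f (\<phi> x)))\<^sup>2)"
  by (simp add: analysis_domain_def frame_integral_def integrable_iff_bounded)

lemma frame_form_self:
  "frame_form M \<phi> f f = of_real (LINT x|M. (norm (cinner f (\<phi> x)))\<^sup>2)"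
  unfolding frame_form_def cinner_right_eq complex_norm_square[symmetric]
  by (simp flip: integral_complex_of_real)

lemma frame_integral_eq:
  "f \<in> analysis_domain M \<phi> \<Longrightarrow> frame_integral M \<phi> f = ennreal (Re (frame_form M \<phi> f f))"
  by (simp add: frame_form_self analysis_domain_iff frame_integral_def nn_integral_eq_integral)

lemma integrable_frame_form:
  assumes "f \<in> analysis_domain M \<phi>" "g \<in> analysis_domain M \<phi>"
  shows "integrable M (\<lambda>x. cinner f (\<phi> x) * cinner (\<phi> x) g)"
proof (rule Bochner_Integration.integrable_bound)
  show "integrable M (\<lambda>x. (norm (cinner f (\<phi> x)))\<^sup>2 + (norm (cinner g (\<phi> x)))\<^sup>2)"
    using assms by (simp add: analysis_domain_iff)
  have "2 * (a * b) \<le> a\<^sup>2 + b\<^sup>2" for a b :: real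
    using zero_le_power2[of "a - b"] by (simp add: power2_eq_square algebra_simps)
  then have "a * b \<le> a\<^sup>2 + b\<^sup>2" if "0 \<le> a" "0 \<le> b" for a b :: real
    using that by (smt (verit) mult_nonneg_nonneg)
  then show "AE x in M. norm (cinner f (\<phi> x) * cinner (\<phi> x) g) \<le>
      norm ((norm (cinner f (\<phi> x)))\<^sup>2 + (norm (cinner g (\<phi> x)))\<^sup>2)"
    unfolding cinner_right_eq by (simp add: norm_mult)
next
  have "(cnj :: complex \<Rightarrow> complex) \<in> borel_measurable borel"
    by (intro borel_measurable_continuous_onI continuous_intros)
  from measurable_compose[OF measurable_coefficient this]
  show "(\<lambda>x. cinner f (\<phi> x) * cinner (\<phi> x) g) \<in> borel_measurable M"
    unfolding cinner_right_eq by (intro borel_measurable_times measurable_coefficient)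
qed

text \<open>Norm convergence of vectors implies pointwise convergence of their coefficients, so this is
  Fatou's lemma.\<close>

lemma analysis_domain_lower_semicontinuous:
  assumes X: "X \<longlonglongrightarrow> f" and K: "\<And>n::nat. frame_integral M \<phi> (X n) \<le> K"
  shows "frame_integral M \<phi> f \<le> K"
proof -
  have lim: "(\<lambda>n. ennreal ((norm (cinner (X n) (\<phi> x)))\<^sup>2)) \<longlonglongrightarrow> ennreal ((norm (cinner f (\<phi> x)))\<^sup>2)" for x
    by (intro tendsto_intros tendsto_ennrealI X)
  have "frame_integral M \<phi> f = (\<integral>\<^sup>+x. liminf (\<lambda>n. ennreal ((norm (cinner (X n) (\<phi> x)))\<^sup>2)) \<partial>M)"
    unfolding frame_integral_def by (intro nn_integral_cong lim_imp_Liminf[OF _ lim, symmetric]) simp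
  also have "\<dots> \<le> liminf (\<lambda>n. frame_integral M \<phi> (X n))"
    unfolding frame_integral_def by (rule nn_integral_liminf) measurable
  also have "\<dots> \<le> liminf (\<lambda>n. K)" by (rule Liminf_mono) (simp add: K)
  finally show ?thesis by (simp add: Liminf_const)
qed

sublocale closed_form "analysis_domain M \<phi>" "frame_form M \<phi>"
proof
  show "0 \<in> analysis_domain M \<phi>" by (simp add: analysis_domain_iff)
  show add: "f + g \<in> analysis_domain M \<phi>" if "f \<in> analysis_domain M \<phi>" "g \<in> analysis_domain M \<phi>" for f g
    unfolding analysis_domain_iff
  proof (rule Bochner_Integration.integrable_bound)
    show "integrable M (\<lambda>x. 2 * (norm (cinner f (\<phi> x)))\<^sup>2 + 2 * (norm (cinner g (\<phi> x)))\<^sup>2)"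
      using that by (simp add: analysis_domain_iff)
    have "(norm (a + b))\<^sup>2 \<le> 2 * (norm a)\<^sup>2 + 2 * (norm b)\<^sup>2" for a b :: complex
    proof -
      have "(norm (a + b))\<^sup>2 \<le> (norm a + norm b)\<^sup>2" by (intro power_mono norm_triangle_ineq) simp
      then show ?thesis using zero_le_power2[of "norm a - norm b"] by (simp add: power2_eq_square algebra_simps)
    qed
    then show "AE x in M. norm ((norm (cinner (f + g) (\<phi> x)))\<^sup>2) \<le>
        norm (2 * (norm (cinner f (\<phi> x)))\<^sup>2 + 2 * (norm (cinner g (\<phi> x)))\<^sup>2)"
      by (simp add: cinner_add_left)
  qed simp
  show "scaleC c f \<in> analysis_domain M \<phi>" if "f \<in> analysis_domain M \<phi>" for c f
    using that by (simp add: analysis_domain_iff cinner_scaleC_left norm_mult power_mult_distrib)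
  show "frame_form M \<phi> (f + g) h = frame_form M \<phi> f h + frame_form M \<phi> g h"
    if "f \<in> analysis_domain M \<phi>" "g \<in> analysis_domain M \<phi>" "h \<in> analysis_domain M \<phi>" for f g h
    using integrable_frame_form that by (simp add: frame_form_def cinner_add_left distrib_right)
  show "frame_form M \<phi> (scaleC c f) g = c * frame_form M \<phi> f g" for c f g
    by (simp add: frame_form_def cinner_scaleC_left mult.assoc)
  show "frame_form M \<phi> f g = cnj (frame_form M \<phi> g f)" for f g
  proof -
    have "cinner f (\<phi> x) * cinner (\<phi> x) g = cnj (cinner g (\<phi> x) * cinner (\<phi> x) f)" for x
      using cinner_commute[of f "\<phi> x"] cinner_commute[of g "\<phi> x"] by simp
    then show ?thesis unfolding frame_form_def by (simp only: Bochner_Integration.integral_cnj)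
  qed
  show "0 \<le> Re (frame_form M \<phi> f f)" for f by (simp add: frame_form_self)
  show "f \<in> analysis_domain M \<phi> \<and> Re (frame_form M \<phi> f f) \<le> K"
    if X: "\<And>n::nat. X n \<in> analysis_domain M \<phi>" "X \<longlonglongrightarrow> f"
      "\<And>n. Re (frame_form M \<phi> (X n) (X n)) \<le> K" for X f K
  proof -
    have "frame_integral M \<phi> f \<le> ennreal K"
      using X(3) by (intro analysis_domain_lower_semicontinuous[OF X(2)])
        (simp add: frame_integral_eq[OF X(1)] ennreal_leI)
    moreover from this have f: "f \<in> analysis_domain M \<phi>"
      unfolding analysis_domain_def infinity_ennreal_def by (simp add: le_less_trans[OF _ ennreal_less_top])
    moreover have "0 \<le> Re (frame_form M \<phi> (X 0) (X 0))" by (simp add: frame_form_self)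
    then have "0 \<le> K" using X(3) order_trans by blast
    ultimately show ?thesis by (simp add: frame_integral_eq)
  qed
qed

end


section \<open>Metric operators and frames\<close>

lemma cinner_apply_operator:
  assumes "self_adjoint G" "range \<phi> \<subseteq> dom G" "G f = Some h"
  shows "cinner f (apply_operator G \<phi> x) = cinner h (\<phi> x)"
proof -
  have "G (\<phi> x) = Some (apply_operator G \<phi> x)"
    using subsetD[OF assms(2) rangeI[of \<phi> x]] by (auto simp: apply_operator_def)
  then show ?thesis using self_adjoint_symmetric[OF assms(1,3)] by simp
qed

lemma frame_integral_apply_operator:
  assumes "self_adjoint G" "range \<phi> \<subseteq> dom G" "G f = Some h"
  shows "frame_integral M (apply_operator G \<phi>) f = frame_integral M \<phi> h"
  unfolding frame_integral_def cinner_apply_operator[OF assms] ..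

text \<open>The upper frame bound puts the range of \<open>G\<close>, which is dense, into the analysis domain.\<close>

lemma analysis_domain_dense_if_bessel:
  assumes G: "metric_operator G" and dom: "range \<phi> \<subseteq> dom G"
    and bessel: "bessel_mapping M (apply_operator G \<phi>)"
  shows "closure (analysis_domain M \<phi>) = UNIV"
proof -
  have self: "self_adjoint G" using G by (simp add: metric_operator_def)
  obtain B :: real where B: "\<And>f. frame_integral M (apply_operator G \<phi>) f \<le> ennreal (B * (norm f)\<^sup>2)"
    using bessel by (auto simp: bessel_mapping_def)
  have "ran G \<subseteq> analysis_domain M \<phi>"
  proof
    fix h assume "h \<in> ran G"
    then obtain f where "G f = Some h" by (auto simp: mem_ran_iff)
    then have "frame_integral M \<phi> h \<le> ennreal (B * (norm f)\<^sup>2)"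
      using B[of f] frame_integral_apply_operator[OF self dom] by metis
    then show "h \<in> analysis_domain M \<phi>"
      by (simp add: analysis_domain_def le_less_trans[OF _ ennreal_less_top])
  qed
  from closure_mono[OF this] show ?thesis
    using self_adjoint_range_dense[OF self] metric_operator_injective[OF G] by blast
qed

text \<open>Surjectivity of \<open>G\<close> carries the lower bound, which controls only vectors \<open>g\<close> in the domain of
  \<open>G\<close> through \<open>Gg\<close>, to all vectors.\<close>

lemma total_if_lower_semi_frame:
  assumes \<phi>: "weakly_measurable M \<phi>" and G: "metric_operator G" and dom: "range \<phi> \<subseteq> dom G"
    and lower: "lower_semi_frame M (apply_operator G \<phi>)" and ran: "ran G = UNIV"
  shows "total_mapping M \<phi>"
  unfolding total_mapping_def
proof (intro conjI \<phi> allI impI)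
  fix h assume "AE x in M. cinner h (\<phi> x) = 0"
  then have "frame_integral M \<phi> h = (\<integral>\<^sup>+x. 0 \<partial>M)"
    unfolding frame_integral_def by (intro nn_integral_cong_AE) auto
  then have 0: "frame_integral M \<phi> h = 0" by simp
  have self: "self_adjoint G" using G by (simp add: metric_operator_def)
  have "h \<in> ran G" using ran by simp
  then obtain g where g: "G g = Some h" by (auto simp: mem_ran_iff)
  obtain m :: real where m: "m > 0" "ennreal (m * (norm g)\<^sup>2) \<le> frame_integral M (apply_operator G \<phi>) g"
    using lower by (auto simp: lower_semi_frame_def)
  then have "m * (norm g)\<^sup>2 \<le> 0"
    unfolding frame_integral_apply_operator[OF self dom g] 0 by (simp add: ennreal_eq_0_iff)
  then have "g = 0" using m(1) by (simp add: mult_le_0_iff)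
  then show "h = 0" using g self unfolding self_adjoint_iff linear_operator_iff by simp
qed

lemma total_if_inverse_bounded:
  assumes \<phi>: "weakly_measurable M \<phi>" and G: "metric_operator G" and dom: "range \<phi> \<subseteq> dom G"
    and lower: "lower_semi_frame M (apply_operator G \<phi>)"
    and bound: "\<And>f h. G f = Some h \<Longrightarrow> norm f \<le> K * norm h"
  shows "total_mapping M \<phi>"
proof -
  have "self_adjoint G" using G by (simp add: metric_operator_def)
  then have "ran G = UNIV" using bound by (rule self_adjoint_range_UNIV)
  then show ?thesis by (rule total_if_lower_semi_frame[OF \<phi> G dom lower])
qed

text \<open>The upper bound for \<open>\<phi>\<close> and the lower bound for \<open>G\<phi>\<close> together bound \<open>G\<^sup>-\<^sup>1\<close>.\<close>

lemma total_if_bessel: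
  assumes bessel: "bessel_mapping M \<phi>" and G: "metric_operator G" and dom: "range \<phi> \<subseteq> dom G"
    and lower: "lower_semi_frame M (apply_operator G \<phi>)"
  shows "total_mapping M \<phi>"
proof -
  have self: "self_adjoint G" using G by (simp add: metric_operator_def)
  obtain B :: real where \<phi>: "weakly_measurable M \<phi>" and
    B: "\<And>f. frame_integral M \<phi> f \<le> ennreal (B * (norm f)\<^sup>2)"
    using bessel by (auto simp: bessel_mapping_def)
  obtain m :: real where m: "m > 0"
    "\<And>f. ennreal (m * (norm f)\<^sup>2) \<le> frame_integral M (apply_operator G \<phi>) f"
    using lower by (auto simp: lower_semi_frame_def)
  have "norm f \<le> sqrt (\<bar>B\<bar> / m) * norm h" if "G f = Some h" for f h
  proof -
    have "ennreal (m * (norm f)\<^sup>2) \<le> ennreal (B * (norm h)\<^sup>2)"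
      using m(2)[of f] B[of h] unfolding frame_integral_apply_operator[OF self dom that] by (rule order_trans)
    also have "\<dots> \<le> ennreal (\<bar>B\<bar> * (norm h)\<^sup>2)" by (intro ennreal_leI mult_right_mono) auto
    finally have "m * (norm f)\<^sup>2 \<le> \<bar>B\<bar> * (norm h)\<^sup>2" by (simp add: ennreal_le_iff)
    then have "(norm f)\<^sup>2 \<le> (\<bar>B\<bar> / m) * (norm h)\<^sup>2" using m(1) by (simp add: field_simps)
    also have "\<dots> = (sqrt (\<bar>B\<bar> / m) * norm h)\<^sup>2" using m(1) by (simp add: power_mult_distrib)
    finally show ?thesis using m(1) by (simp add: power2_le_iff_abs_le)
  qed
  then show ?thesis by (rule total_if_inverse_bounded[OF \<phi> G dom lower])
qed

text \<open>Lower semicontinuity gives \<open>\<Omega>(f, f) \<le> \<parallel>f\<parallel>\<^sup>2\<close> for every \<open>f\<close>. So \<open>\<Omega>\<close> is bounded and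
  hence continuous, and the equality passes to limits.\<close>

lemma parseval_frame_if_on_dense:
  assumes \<psi>: "weakly_measurable M \<psi>" and W: "closure W = UNIV"
    and iso: "\<And>f. f \<in> W \<Longrightarrow> frame_integral M \<psi> f = ennreal ((norm f)\<^sup>2)"
  shows "parseval_frame M \<psi>"
  unfolding parseval_frame_def
proof (intro conjI \<psi> allI)
  interpret weakly_measurable_mapping M \<psi> by unfold_locales (rule \<psi>)
  let ?Q = "\<lambda>f. Re (frame_form M \<psi> f f)"
  have approx: "\<exists>X. (\<forall>n. X n \<in> W) \<and> X \<longlonglongrightarrow> f" for f
    using W closure_sequential[of f W] by auto
  have W_domain: "f \<in> analysis_domain M \<psi>" "?Q f = (norm f)\<^sup>2" if "f \<in> W" for f
  proof -
    show f: "f \<in> analysis_domain M \<psi>" using iso[OF that] by (simp add: analysis_domain_def)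
    show "?Q f = (norm f)\<^sup>2" using iso[OF that] frame_integral_eq[OF f] by (simp add: form_nonneg[OF f])
  qed
  have upper: "f \<in> analysis_domain M \<psi> \<and> ?Q f \<le> K" if K: "(norm f)\<^sup>2 < K" for f K
  proof -
    obtain X where X: "\<And>n. X n \<in> W" "X \<longlonglongrightarrow> f" using approx by blast
    have "(\<lambda>n. (norm (X n))\<^sup>2) \<longlonglongrightarrow> (norm f)\<^sup>2" by (intro tendsto_intros X)
    from order_tendstoD(2)[OF this K] obtain N where N: "\<And>n. n \<ge> N \<Longrightarrow> (norm (X n))\<^sup>2 < K"
      by (auto simp: eventually_sequentially)
    show ?thesis
    proof (rule lower_semicontinuous)
      show "(\<lambda>n. X (n + N)) \<longlonglongrightarrow> f" by (rule LIMSEQ_ignore_initial_segment[OF X(2)])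
      show "X (n + N) \<in> analysis_domain M \<psi>" for n by (rule W_domain[OF X(1)])
      show "?Q (X (n + N)) \<le> K" for n using W_domain(2)[OF X(1)] N[of "n + N"] by simp
    qed
  qed
  have domain: "f \<in> analysis_domain M \<psi>" for f using upper[OF less_add_one] by blast
  have Q_le: "?Q f \<le> (norm f)\<^sup>2" for f by (rule dense_ge) (use upper in blast)
  fix f
  obtain X where X: "\<And>n. X n \<in> W" "X \<longlonglongrightarrow> f" using approx by blast
  have below: "(norm (X n))\<^sup>2 - 2 * (norm (X n) * norm (f - X n)) \<le> ?Q f" for n
  proof -
    let ?E = "frame_form M \<psi> (X n) (f - X n)"
    have "(norm ?E)\<^sup>2 \<le> ?Q (X n) * ?Q (f - X n)" by (rule Cauchy_Schwarz[OF domain domain])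
    also have "\<dots> \<le> (norm (X n))\<^sup>2 * (norm (f - X n))\<^sup>2"
      by (intro mult_mono Q_le form_nonneg domain zero_le_power2)
    finally have "(norm ?E)\<^sup>2 \<le> (norm (X n) * norm (f - X n))\<^sup>2" by (simp add: power_mult_distrib)
    then have "norm ?E \<le> norm (X n) * norm (f - X n)" by (simp add: power2_le_iff_abs_le)
    then have "- (norm (X n) * norm (f - X n)) \<le> Re ?E" using abs_Re_le_cmod[of ?E] by linarith
    moreover have "?Q f = ?Q (X n) + ?Q (f - X n) + 2 * Re ?E"
      using quadratic_add[OF domain domain, of "X n" "f - X n"] by simp
    ultimately show ?thesis using form_nonneg[OF domain, of "f - X n"] W_domain(2)[OF X(1), of n] by linarith
  qed
  have "(\<lambda>n. (norm (X n))\<^sup>2 - 2 * (norm (X n) * norm (f - X n))) \<longlonglongrightarrow>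
      (norm f)\<^sup>2 - 2 * (norm f * norm (f - f))"
    by (intro tendsto_intros X)
  then have "(norm f)\<^sup>2 - 2 * (norm f * norm (f - f)) \<le> ?Q f"
    by (rule LIMSEQ_le_const2) (use below in blast)
  then have "?Q f = (norm f)\<^sup>2" using Q_le[of f] by simp
  then show "frame_integral M \<psi> f = ennreal ((norm f)\<^sup>2)" using frame_integral_eq[OF domain] by simp
qed

text \<open>Coefficients against vectors in the domain of \<open>G\<close> are coefficients of \<open>\<phi>\<close>; the others are
  pointwise limits of these.\<close>

lemma weakly_measurable_apply_operator:
  assumes \<phi>: "weakly_measurable M \<phi>" and G: "self_adjoint G" and dom: "range \<phi> \<subseteq> dom G"
  shows "weakly_measurable M (apply_operator G \<phi>)"
  unfolding weakly_measurable_def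
proof
  fix f
  have "closure (dom G) = UNIV" using G by (simp add: self_adjoint_iff densely_defined_def)
  then have "f \<in> closure (dom G)" by simp
  then obtain X where X: "\<And>n. X n \<in> dom G" "X \<longlonglongrightarrow> f" unfolding closure_sequential by blast
  define Y where "Y n = the (G (X n))" for n
  have Y: "G (X n) = Some (Y n)" for n using X(1)[of n] by (auto simp: Y_def)
  show "(\<lambda>x. cinner f (apply_operator G \<phi> x)) \<in> borel_measurable M"
  proof (rule borel_measurable_LIMSEQ_metric)
    show "(\<lambda>x. cinner (X n) (apply_operator G \<phi> x)) \<in> borel_measurable M" for n
      unfolding cinner_apply_operator[OF G dom Y] using \<phi> by (simp add: weakly_measurable_def)
    show "(\<lambda>n. cinner (X n) (apply_operator G \<phi> x)) \<longlonglongrightarrow> cinner f (apply_operator G \<phi> x)" for x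
      by (intro tendsto_intros X)
  qed
qed

context weakly_measurable_mapping
begin

text \<open>The existence theorem justifies the choice operator in \<^const>\<open>sqrt_operator\<close>; whichever root
  it picks, the representation theorem applies to it.\<close>

lemma sqrt_frame_operator:
  assumes dense: "closure (analysis_domain M \<phi>) = UNIV"
  defines "S \<equiv> sqrt_operator (frame_operator M \<phi>)"
  shows "self_adjoint S" "nonneg_operator S" "S \<circ>\<^sub>m S = frame_operator M \<phi>"
    and "S f = Some h \<Longrightarrow> frame_integral M \<phi> f = ennreal ((norm h)\<^sup>2)"
proof -
  interpret dense_closed_form "analysis_domain M \<phi>" "frame_form M \<phi>"
    by unfold_locales (rule dense)
  have T: "frame_operator M \<phi> = form_operator"
    by (rule ext) (simp add: frame_operator_def form_operator_def dense)
  have "\<exists>S. self_adjoint S \<and> nonneg_operator S \<and> S \<circ>\<^sub>m S = frame_operator M \<phi>"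
    unfolding T using form_operator_square_root by blast
  from someI_ex[OF this] show S: "self_adjoint S" "nonneg_operator S" "S \<circ>\<^sub>m S = frame_operator M \<phi>"
    unfolding S_def sqrt_operator_def by blast+
  show "frame_integral M \<phi> f = ennreal ((norm h)\<^sup>2)" if "S f = Some h"
    using norm_square_root_eq_form[OF S(1) S(3)[unfolded T] that] frame_integral_eq by simp
qed

text \<open>On \<open>f = Sh\<close> the frame integral of \<open>S\<^sup>-\<^sup>1\<phi>\<close> is that of \<open>\<phi>\<close> at \<open>h\<close>, namely \<open>\<parallel>Sh\<parallel>\<^sup>2 = \<parallel>f\<parallel>\<^sup>2\<close>, and
  these \<open>f\<close> are dense.\<close>

lemma inverse_sqrt_frame_operator:
  assumes dense: "closure (analysis_domain M \<phi>) = UNIV" and total: "total_mapping M \<phi>"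
    and ran: "range \<phi> \<subseteq> ran (sqrt_operator (frame_operator M \<phi>))"
  defines "G \<equiv> inverse_operator (sqrt_operator (frame_operator M \<phi>))"
  shows "metric_operator G \<and> range \<phi> \<subseteq> dom G \<and> parseval_frame M (apply_operator G \<phi>)"
proof -
  define S where "S = sqrt_operator (frame_operator M \<phi>)"
  note S = sqrt_frame_operator[OF dense, folded S_def]
  have lin: "linear_operator S" using S(1) by (simp add: self_adjoint_iff)
  have inj: "f = 0" if "S f = Some 0" for f
  proof -
    have "(\<integral>\<^sup>+x. ennreal ((norm (cinner f (\<phi> x)))\<^sup>2) \<partial>M) = 0"
      using S(4)[OF that] by (simp add: frame_integral_def)
    then have "AE x in M. cinner f (\<phi> x) = 0" by (subst (asm) nn_integral_0_iff_AE) auto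
    then show ?thesis using total by (simp add: total_mapping_def)
  qed
  have G: "G h = Some f \<longleftrightarrow> S f = Some h" for f h
    unfolding G_def S_def[symmetric] using inverse_operator_iff[OF lin] inj by blast
  have metric: "metric_operator G"
    unfolding G_def S_def[symmetric] using metric_operator_inverse[OF S(1,2)] inj by blast
  then have self: "self_adjoint G" by (simp add: metric_operator_def)
  have dom: "range \<phi> \<subseteq> dom G"
    using ran by (auto simp: S_def[symmetric] mem_ran_iff dom_def G subset_iff)
  have "parseval_frame M (apply_operator G \<phi>)"
  proof (rule parseval_frame_if_on_dense)
    show "weakly_measurable M (apply_operator G \<phi>)"
      by (rule weakly_measurable_apply_operator[OF weakly_measurable self dom])
    show "closure (dom G) = UNIV" using self by (simp add: self_adjoint_iff densely_defined_def)
    fix f assume "f \<in> dom G"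
    then obtain h where h: "G f = Some h" by blast
    then have "S h = Some f" by (simp add: G)
    then show "frame_integral M (apply_operator G \<phi>) f = ennreal ((norm f)\<^sup>2)"
      using S(4) frame_integral_apply_operator[OF self dom h] by simp
  qed
  with metric dom show ?thesis by blast
qed

lemma lower_semi_frame_imp_total:
  assumes "lower_semi_frame M \<phi>"
  shows "total_mapping M \<phi>"
  unfolding total_mapping_def
proof (intro conjI weakly_measurable allI impI)
  fix f assume "AE x in M. cinner f (\<phi> x) = 0"
  then have "frame_integral M \<phi> f = (\<integral>\<^sup>+x. 0 \<partial>M)"
    unfolding frame_integral_def by (intro nn_integral_cong_AE) auto
  moreover obtain m :: real where "m > 0" "ennreal (m * (norm f)\<^sup>2) \<le> frame_integral M \<phi> f"
    using assms by (auto simp: lower_semi_frame_def)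
  ultimately have "m > 0" "m * (norm f)\<^sup>2 \<le> 0" by (simp_all add: ennreal_eq_0_iff)
  then show "f = 0" by (simp add: mult_le_0_iff)
qed

text \<open>The lower frame bound says that the root is bounded below.\<close>

lemma range_sqrt_frame_operator_UNIV:
  assumes dense: "closure (analysis_domain M \<phi>) = UNIV" and lower: "lower_semi_frame M \<phi>"
  shows "ran (sqrt_operator (frame_operator M \<phi>)) = UNIV"
proof -
  obtain m :: real where m: "m > 0" "\<And>f. ennreal (m * (norm f)\<^sup>2) \<le> frame_integral M \<phi> f"
    using lower by (auto simp: lower_semi_frame_def)
  show ?thesis
  proof (rule self_adjoint_range_UNIV[OF sqrt_frame_operator(1)[OF dense]])
    fix f h assume "sqrt_operator (frame_operator M \<phi>) f = Some h"
    then have "m * (norm f)\<^sup>2 \<le> (norm h)\<^sup>2"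
      using m(2)[of f] sqrt_frame_operator(4)[OF dense] by (simp add: ennreal_le_iff)
    then have "(norm f)\<^sup>2 \<le> (sqrt (1 / m) * norm h)\<^sup>2"
      using m(1) by (simp add: power_mult_distrib field_simps)
    then show "norm f \<le> sqrt (1 / m) * norm h" using m(1) by (simp add: power2_le_iff_abs_le)
  qed
qed

lemma range_frame_operator_subset:
  assumes "closure (analysis_domain M \<phi>) = UNIV"
  shows "ran (frame_operator M \<phi>) \<subseteq> ran (sqrt_operator (frame_operator M \<phi>))"
  using sqrt_frame_operator(3)[OF assms] map_comp_eq_Some_iff unfolding mem_ran_iff subset_iff by metis

end

theorem theorem6p1:
  fixes M :: "'x::t2_space measure"
    and \<phi> :: "'x \<Rightarrow> 'h::complex_hilbert"
  assumes "locally_compact_space (euclidean :: 'x topology)"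
    and "radon_measure M"
    and "separable_space (euclidean :: 'h topology)"
    and "weakly_measurable M \<phi>"
  shows "(\<not> total_mapping M \<phi> \<longrightarrow>
           \<not> (\<exists>G. metric_operator G \<and> range \<phi> \<subseteq> dom G \<and>
                 continuous_frame M (apply_operator G \<phi>) \<and>
                 bounded_operator (inverse_operator G))) \<and>
         (bessel_mapping M \<phi> \<and> \<not> total_mapping M \<phi> \<longrightarrow>
           \<not> (\<exists>G. metric_operator G \<and> range \<phi> \<subseteq> dom G \<and>
                 continuous_frame M (apply_operator G \<phi>))) \<and>
         (closure (analysis_domain M \<phi>) \<noteq> UNIV \<longrightarrow>
           \<not> (\<exists>G. metric_operator G \<and> range \<phi> \<subseteq> dom G \<and>
                 continuous_frame M (apply_operator G \<phi>))) \<and>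
         (closure (analysis_domain M \<phi>) = UNIV \<and> lower_semi_frame M \<phi> \<longrightarrow>
           (\<exists>G. metric_operator G \<and> range \<phi> \<subseteq> dom G \<and>
                parseval_frame M (apply_operator G \<phi>)) \<and>
           (let G = inverse_operator (sqrt_operator (frame_operator M \<phi>))
            in metric_operator G \<and> range \<phi> \<subseteq> dom G \<and>
               parseval_frame M (apply_operator G \<phi>))) \<and>
         (total_mapping M \<phi> \<and> closure (analysis_domain M \<phi>) = UNIV \<and>
         range \<phi> \<subseteq> ran (frame_operator M \<phi>) \<longrightarrow>
           (\<exists>G. metric_operator G \<and> range \<phi> \<subseteq> dom G \<and>
                parseval_frame M (apply_operator G \<phi>)) \<and>
           (let G = inverse_operator (sqrt_operator (frame_operator M \<phi>))
            in metric_operator G \<and> range \<phi> \<subseteq> dom G \<and>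
               parseval_frame M (apply_operator G \<phi>)))"
    (is "(_ \<longrightarrow> \<not> ?i) \<and> (_ \<longrightarrow> \<not> ?ii) \<and> (_ \<longrightarrow> \<not> ?iii) \<and> (?iv \<longrightarrow> ?ex \<and> ?root) \<and> (?v \<longrightarrow> ?ex \<and> ?root)")
proof -
  interpret weakly_measurable_mapping M \<phi> by unfold_locales fact
  have i: "total_mapping M \<phi>" if ex_G: ?i
  proof -
    obtain G K where G: "metric_operator G" "range \<phi> \<subseteq> dom G" "continuous_frame M (apply_operator G \<phi>)"
      and K: "\<forall>h\<in>dom (inverse_operator G). norm (the (inverse_operator G h)) \<le> K * norm h"
      using ex_G unfolding bounded_operator_def by blast
    have lin: "linear_operator G" using G(1) by (simp add: metric_operator_def self_adjoint_iff)
    have bound: "norm f \<le> K * norm h" if "G f = Some h" for f h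
    proof -
      have "inverse_operator G h = Some f"
        using inverse_operator_iff[OF lin] metric_operator_injective[OF G(1)] that by blast
      then show ?thesis using bspec[OF K, of h] by (simp add: domI)
    qed
    show ?thesis
      using G(3) bound by (intro total_if_inverse_bounded[OF weakly_measurable G(1,2)])
        (auto simp: continuous_frame_def)
  qed
  have ii: "total_mapping M \<phi>" if "bessel_mapping M \<phi>" ?ii
    using that total_if_bessel unfolding continuous_frame_def by blast
  have iii: "closure (analysis_domain M \<phi>) = UNIV" if ?iii
    using that analysis_domain_dense_if_bessel unfolding continuous_frame_def by blast
  have iv: ?root if ?iv
    using that inverse_sqrt_frame_operator lower_semi_frame_imp_total range_sqrt_frame_operator_UNIV
    unfolding Let_def by blast
  have v: ?root if ?v
    using that inverse_sqrt_frame_operator range_frame_operator_subset unfolding Let_def by blast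
  have ex: ?ex if ?root
    using that unfolding Let_def by blast
  show ?thesis using i ii iii iv v ex by blast
qed

end
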